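(* Any linear differential equation $F[u]=0$ is nonlinearly self-adjoint.
   Context: Here $F$ is a linear differential operator (of order at least one) acting on one dependent variable $u$ of independent variables $x=(x^1,\ldots,x^n)$, with locally analytic coefficients depending on $x$. All considerations are local. For a differential equation $F(x,u,u_{(1)},\ldots,u_{(s)})=0$ (with $u_{(k)}$ the set of $k$-th order partial derivatives of $u$), the adjoint equation is $F^*\equiv\frac{\delta(vF)}{\delta u}=0$, where $v$ is a new dependent variable and $$\frac{\delta}{\delta u}=\frac{\partial}{\partial u}+\sum_{r\ge1}(-1)^rD_{i_1}\cdots D_{i_r}\frac{\partial}{\partial u_{i_1\cdots i_r}},$$ with $D_i$ the total differentiation with respect to $x^i$ (acting on $u$, $v$ and their derivatives). The equation is called nonlinearly self-adjoint if there exists a function $\varphi(x,u)$, not identically zero, such that $v=\varphi(x,u)$ solves the adjoint equation for all solutions $u(x)$ of the equation $F=0$.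
   Formalization: "Local" is taken to mean near each point where some highest-order coefficient is nonzero (such points are shown to be dense); at other points the claim can fail, e.g. x u' = 0 near x = 0, where the adjoint equation (x v)' = 0 forces φ = 0. *)

theory Defs
  imports "HOL-Analysis.Analysis" "HOL-Library.Multiset" "HOL-Library.Groups_Big_Fun"
begin

(* A multiset over Basis is the exponent of a monomial; has_sum makes the power series
   converge absolutely. *)
definition real_analytic_on :: "('a::euclidean_space \<Rightarrow> real) \<Rightarrow> 'a set \<Rightarrow> bool" where
  "real_analytic_on f S \<longleftrightarrow>
     (\<forall>x0\<in>S. \<exists>r>0. \<exists>c :: 'a multiset \<Rightarrow> real. \<forall>x\<in>ball x0 r.
        ((\<lambda>\<alpha>. c \<alpha> * (\<Prod>b\<in>#\<alpha>. (x - x0) \<bullet> b)) has_sum f x) {\<alpha>. set_mset \<alpha> \<subseteq> Basis})"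

definition partial_deriv :: "'n::finite \<Rightarrow> (real^'n \<Rightarrow> real) \<Rightarrow> real^'n \<Rightarrow> real" where
  "partial_deriv i f x = deriv (\<lambda>t. f (x + t *\<^sub>R axis i 1)) 0"

definition partial_derivs :: "'n::finite list \<Rightarrow> (real^'n \<Rightarrow> real) \<Rightarrow> real^'n \<Rightarrow> real" where
  "partial_derivs is f = foldr partial_deriv is f"

definition smooth_on :: "(real^'n::finite \<Rightarrow> real) \<Rightarrow> (real^'n) set \<Rightarrow> bool" where
  "smooth_on f S \<longleftrightarrow> (\<forall>is. partial_derivs is f differentiable_on S)"

(* The derivative coordinate with indices i1, ..., ir is indexed by the multiset {#i1, ..., ir#},
   so coordinates differing only in the order of their indices are the same coordinate.
   The enumeration chosen here is immaterial wherever derivatives commute. *)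
definition indices :: "'n multiset \<Rightarrow> 'n list" where
  "indices \<alpha> = (SOME is. mset is = \<alpha>)"

type_synonym 'n jet = "'n multiset \<Rightarrow> real"

definition jet_of :: "(real^'n::finite \<Rightarrow> real) \<Rightarrow> real^'n \<Rightarrow> 'n jet" where
  "jet_of u x = (\<lambda>\<alpha>. partial_derivs (indices \<alpha>) u x)"

(* Functions of x, of u and its derivatives, and of v and its derivatives. *)
type_synonym 'n diff_fun = "real^'n \<Rightarrow> 'n jet \<Rightarrow> 'n jet \<Rightarrow> real"

definition D_x :: "'n::finite \<Rightarrow> 'n diff_fun \<Rightarrow> 'n diff_fun" where
  "D_x i L x u v = deriv (\<lambda>t. L (x + t *\<^sub>R axis i 1) u v) 0"

definition D_u :: "'n::finite multiset \<Rightarrow> 'n diff_fun \<Rightarrow> 'n diff_fun" where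
  "D_u \<alpha> L x u v = deriv (\<lambda>t. L x (u(\<alpha> := t)) v) (u \<alpha>)"

definition D_v :: "'n::finite multiset \<Rightarrow> 'n diff_fun \<Rightarrow> 'n diff_fun" where
  "D_v \<alpha> L x u v = deriv (\<lambda>t. L x u (v(\<alpha> := t))) (v \<alpha>)"

(* Sum_any adds the nonzero terms; there are finitely many of them whenever L depends on
   derivatives of u and v up to some finite order only. *)
definition total_deriv :: "'n::finite \<Rightarrow> 'n diff_fun \<Rightarrow> 'n diff_fun" where
  "total_deriv i L x u v =
     D_x i L x u v
     + Sum_any (\<lambda>\<alpha>. u (add_mset i \<alpha>) * D_u \<alpha> L x u v)
     + Sum_any (\<lambda>\<alpha>. v (add_mset i \<alpha>) * D_v \<alpha> L x u v)"

definition total_derivs :: "'n::finite list \<Rightarrow> 'n diff_fun \<Rightarrow> 'n diff_fun" where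
  "total_derivs is L = foldr total_deriv is L"

(* Each derivative coordinate of u contributes one term, the empty multiset giving the
   derivative with respect to u itself. *)
definition variational_deriv_u :: "'n::finite diff_fun \<Rightarrow> 'n diff_fun" where
  "variational_deriv_u L x u v =
     Sum_any (\<lambda>\<alpha>. (-1) ^ size \<alpha> * total_derivs (indices \<alpha>) (D_u \<alpha> L) x u v)"

definition adjoint_fun :: "(real^'n::finite \<Rightarrow> 'n jet \<Rightarrow> real) \<Rightarrow> 'n diff_fun" where
  "adjoint_fun F = variational_deriv_u (\<lambda>x u v. v {#} * F x u)"

definition solution_on :: "(real^'n::finite \<Rightarrow> 'n jet \<Rightarrow> real) \<Rightarrow> (real^'n \<Rightarrow> real) \<Rightarrow> (real^'n) set \<Rightarrow> bool"
  where "solution_on F u V \<longleftrightarrow> smooth_on u V \<and> (\<forall>x\<in>V. F x (jet_of u x) = 0)"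

(* The sets V allow for solutions u that exist on a part of U only. *)
definition nonlinearly_self_adjoint_on ::
    "(real^'n::finite \<Rightarrow> 'n jet \<Rightarrow> real) \<Rightarrow> (real^'n) set \<Rightarrow> bool" where
  "nonlinearly_self_adjoint_on F U \<longleftrightarrow>
     (\<exists>\<phi> :: real^'n \<Rightarrow> real \<Rightarrow> real.
        real_analytic_on (\<lambda>(x, w). \<phi> x w) (U \<times> UNIV) \<and>
        (\<exists>x\<in>U. \<exists>w. \<phi> x w \<noteq> 0) \<and>
        (\<forall>V u. open V \<and> V \<subseteq> U \<and> solution_on F u V \<longrightarrow>
           (\<forall>x\<in>V. adjoint_fun F x (jet_of u x) (jet_of (\<lambda>y. \<phi> y (u y)) x) = 0)))"

definition linear_diff_op ::
    "nat \<Rightarrow> ('n::finite multiset \<Rightarrow> real^'n \<Rightarrow> real) \<Rightarrow> real^'n \<Rightarrow> 'n jet \<Rightarrow> real" where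
  "linear_diff_op s a x u = (\<Sum>\<alpha> | size \<alpha> \<le> s. a \<alpha> x * u \<alpha>)"

(* The points where the order of the operator does not drop below s. At other points there
   need not be a suitable \<phi>: for x u' = 0 on the real line the adjoint equation is
   (x v)' = 0, and its only solution around 0 is v = 0. *)
definition regular_points ::
    "nat \<Rightarrow> ('n::finite multiset \<Rightarrow> real^'n \<Rightarrow> real) \<Rightarrow> (real^'n) set \<Rightarrow> (real^'n) set" where
  "regular_points s a \<Omega> = {x \<in> \<Omega>. \<exists>\<alpha>. size \<alpha> = s \<and> a \<alpha> x \<noteq> 0}"

end

(* The adjoint of a linear operator of order s is again linear in v and does not involve u; up to
   sign it has the same coefficients of order s. So it suffices to take for \<phi> a nonzero analytic
   solution f of the adjoint equation. At a regular point x0 such a solution comes from a Goursat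
   problem: among the multi-indices of order s with nonzero coefficient at x0, let \<beta> be one of
   maximal Euclidean norm, and put f = 1 + I g, where I is the \<beta>-fold antiderivative. This turns
   the equation into g = h + T g on power series coefficients. In an l^1 norm with
   weights r^\<gamma> \<gamma>! / (size \<gamma>)!, where r_i = \<rho> t^(\<beta>_i), the operator T is a contraction: t small makes
   the terms of order s that are nonzero at x0 small because \<beta> is a vertex, and then \<rho> small takes
   care of all other terms.
   Density of the regular points is the identity theorem for real analytic functions. *)
theory Submission
  imports Defs "HOL-Combinatorics.Multiset_Permutations" "HOL-Complex_Analysis.Cauchy_Integral_Formula"
begin

subsection \<open>Power series in several variables\<close>

text \<open>A Cauchy problem would need a coordinate direction whose pure derivative of order s has
  a nonzero coefficient at x0, while the nonzero coefficients there may all belong to mixed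
  derivatives. Solving for a mixed derivative \<beta> avoids a change of coordinates, but leaves
  other terms of order s whose coefficients do not become small near x0. Isotropic shrinking does
  not help, because these terms have the same homogeneity as the leading one; anisotropic radii do.
  With r_i = \<rho> t^(\<beta>_i) the \<alpha>-th derivative of I g costs a factor of at most
  r^\<beta> / r^\<alpha> = \<rho>^(s - |\<alpha>|) t^(\<beta>.\<beta> - \<beta>.\<alpha>), and for
  \<alpha> \<noteq> \<beta> of order s with nonzero coefficient at x0 the exponent of t is an
  integer \<ge> 1. For the other terms that exponent may be negative, which is why t is fixed first:
  a lower order gives a factor \<rho>, and a coefficient vanishing at x0 has a series starting in
  degree one, so a small \<rho> pays for any fixed negative power of t. The summand 1 makes f
  nonzero at x0, since I g vanishes there when s \<ge> 1.\<close>

definition mpow :: "('n \<Rightarrow> real) \<Rightarrow> 'n multiset \<Rightarrow> real" where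
  "mpow y \<gamma> = (\<Prod>i\<in>#\<gamma>. y i)"

definition mfact :: "'n::finite multiset \<Rightarrow> real" where
  "mfact \<gamma> = (\<Prod>i\<in>UNIV. fact (count \<gamma> i))"

lemma mpow_empty [simp]: "mpow y {#} = 1"
  and mpow_add_mset [simp]: "mpow y (add_mset i \<gamma>) = y i * mpow y \<gamma>"
  and mpow_union: "mpow y (\<gamma> + \<delta>) = mpow y \<gamma> * mpow y \<delta>"
  and mpow_const [simp]: "mpow (\<lambda>_. c) \<gamma> = c ^ size \<gamma>"
  by (simp_all add: mpow_def)

lemma mpow_nonneg: "(\<And>i. 0 \<le> y i) \<Longrightarrow> 0 \<le> mpow y \<gamma>"
  by (induction \<gamma>) auto

lemma mpow_pos: "(\<And>i. 0 < y i) \<Longrightarrow> 0 < mpow y \<gamma>"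
  by (induction \<gamma>) auto

lemma mpow_mono: "(\<And>i. 0 \<le> y i) \<Longrightarrow> (\<And>i. y i \<le> z i) \<Longrightarrow> mpow y \<gamma> \<le> mpow z \<gamma>"
  by (induction \<gamma>) (auto intro!: mult_mono mpow_nonneg intro: order_trans)

lemma abs_mpow: "\<bar>mpow y \<gamma>\<bar> = mpow (\<lambda>i. \<bar>y i\<bar>) \<gamma>"
  by (induction \<gamma>) (auto simp: abs_mult)

lemma abs_mpow_le: "(\<And>i. \<bar>y i\<bar> \<le> R) \<Longrightarrow> \<bar>mpow y \<gamma>\<bar> \<le> R ^ size \<gamma>"
  unfolding abs_mpow mpow_const[symmetric] by (rule mpow_mono) auto

lemma mpow_eq_prod: "mpow y \<gamma> = (\<Prod>i\<in>UNIV. y i ^ count \<gamma> i)" for y :: "'n::finite \<Rightarrow> real"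
proof (induction \<gamma>)
  case (add j \<gamma>)
  have "(\<Prod>i\<in>UNIV. y i ^ count (add_mset j \<gamma>) i)
      = (\<Prod>i\<in>UNIV. (if i = j then y j else 1) * y i ^ count \<gamma> i)"
    by (intro prod.cong) auto
  with add show ?case by (simp add: prod.distrib)
qed simp

lemma mpow_scale: "mpow (\<lambda>i. t * y i) \<gamma> = t ^ size \<gamma> * mpow y \<gamma>"
  by (induction \<gamma>) auto

lemma mfact_pos [simp]: "0 < mfact \<gamma>"
  by (auto simp: mfact_def intro!: prod_pos)

lemma mfact_nonzero [simp]: "mfact \<gamma> \<noteq> 0"
  using mfact_pos[of \<gamma>] by linarith

lemma mfact_empty [simp]: "mfact {#} = 1"
  by (simp add: mfact_def)

lemma mfact_add_mset: "mfact (add_mset i \<gamma>) = (count \<gamma> i + 1) * mfact \<gamma>"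
proof -
  have "mfact (add_mset i \<gamma>) = (\<Prod>j\<in>UNIV. (if j = i then real (count \<gamma> i + 1) else 1) * fact (count \<gamma> j))"
    unfolding mfact_def by (intro prod.cong) auto
  then show ?thesis by (simp add: prod.distrib mfact_def)
qed

lemma finite_size_le [simp]: "finite {\<gamma> :: 'n::finite multiset. size \<gamma> \<le> m}"
proof -
  have "{\<gamma> :: 'n multiset. size \<gamma> \<le> m} = (\<Union>k\<le>m. multisets_of_size UNIV k)"
    by (auto simp: multisets_of_size_def)
  then show ?thesis by (simp add: finite_multisets_of_size)
qed

lemma finite_subseteq_mset [simp]: "finite {\<delta> :: 'n::finite multiset. \<delta> \<subseteq># \<gamma>}"
  by (rule finite_subset[OF _ finite_size_le[of "size \<gamma>"]]) (auto simp: size_mset_mono)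

text \<open>This is the product over all coordinates of the one-variable binomial theorem; the
  choice functions that arise when the product of sums is expanded are the count functions of the
  submultisets of \<gamma>.\<close>

lemma mpow_binomial:
  fixes \<gamma> :: "'n::finite multiset"
  shows "mpow (\<lambda>i. h i + y i) \<gamma> =
    (\<Sum>\<delta> | \<delta> \<subseteq># \<gamma>. mfact \<gamma> / (mfact \<delta> * mfact (\<gamma> - \<delta>)) * (mpow h \<delta> * mpow y (\<gamma> - \<delta>)))"
proof -
  have "mpow (\<lambda>i. h i + y i) \<gamma> = (\<Prod>i\<in>UNIV. \<Sum>k\<le>count \<gamma> i. of_nat (count \<gamma> i choose k) * h i ^ k * y i ^ (count \<gamma> i - k))"
    by (simp add: mpow_eq_prod binomial_ring)
  also have "\<dots> = (\<Sum>p\<in>Pi\<^sub>E UNIV (\<lambda>i. {..count \<gamma> i}). \<Prod>i\<in>UNIV. of_nat (count \<gamma> i choose p i) * h i ^ p i * y i ^ (count \<gamma> i - p i))"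
    by (rule prod_sum_PiE) auto
  also have "\<dots> = (\<Sum>\<delta> | \<delta> \<subseteq># \<gamma>. \<Prod>i\<in>UNIV. of_nat (count \<gamma> i choose count \<delta> i) * h i ^ count \<delta> i * y i ^ (count \<gamma> i - count \<delta> i))"
    by (rule sum.reindex_bij_witness[of _ count Abs_multiset])
       (auto simp: PiE_def Pi_def subseteq_mset_def Abs_multiset_inverse count_inverse)
  also have "\<dots> = (\<Sum>\<delta> | \<delta> \<subseteq># \<gamma>. mfact \<gamma> / (mfact \<delta> * mfact (\<gamma> - \<delta>)) * (mpow h \<delta> * mpow y (\<gamma> - \<delta>)))"
  proof (intro sum.cong refl)
    fix \<delta> assume "\<delta> \<in> {\<delta>. \<delta> \<subseteq># \<gamma>}"
    then have le: "count \<delta> i \<le> count \<gamma> i" for i by (auto simp: subseteq_mset_def)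
    show "(\<Prod>i\<in>UNIV. of_nat (count \<gamma> i choose count \<delta> i) * h i ^ count \<delta> i * y i ^ (count \<gamma> i - count \<delta> i))
      = mfact \<gamma> / (mfact \<delta> * mfact (\<gamma> - \<delta>)) * (mpow h \<delta> * mpow y (\<gamma> - \<delta>))"
      by (simp add: mpow_eq_prod mfact_def binomial_fact[OF le] prod.distrib prod_dividef)
  qed
  finally show ?thesis .
qed

section \<open>Rearrangement of sums over multi-indices\<close>

lemma summable_on_comparison_real:
  fixes f g :: "'a \<Rightarrow> real"
  assumes "g summable_on A" and "\<And>x. x \<in> A \<Longrightarrow> \<bar>f x\<bar> \<le> g x"
  shows "f summable_on A"
  by (rule abs_summable_summable, rule Infinite_Sum.abs_summable_on_comparison_test'[OF assms(1)]) (use assms(2) in auto)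

text \<open>A pair (\<delta>, \<epsilon>) is the same as \<gamma> = \<delta> + \<epsilon> with a
  marked submultiset \<delta>, and each \<gamma> has only finitely many of them. Both the Cauchy
  product and the expansion about a new centre are regrouped in this way.\<close>

lemma has_sum_by_total:
  fixes f :: "'n::finite multiset \<times> 'n multiset \<Rightarrow> real"
  assumes "(f has_sum S) UNIV"
  shows "((\<lambda>\<gamma>. \<Sum>\<delta> | \<delta> \<subseteq># \<gamma>. f (\<delta>, \<gamma> - \<delta>)) has_sum S) UNIV"
proof -
  have "((\<lambda>(\<gamma>, \<delta>). f (\<delta>, \<gamma> - \<delta>)) has_sum S) (SIGMA \<gamma>:UNIV. {\<delta>. \<delta> \<subseteq># \<gamma>})"
    using assms
    by (subst has_sum_reindex_bij_witness[where T = UNIV and h = f and s' = S and i = "\<lambda>(\<delta>, \<epsilon>). (\<delta> + \<epsilon>, \<delta>)" and j = "\<lambda>(\<gamma>, \<delta>). (\<delta>, \<gamma> - \<delta>)"])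
       (auto simp: subset_mset.add_diff_inverse)
  then show ?thesis
    by (rule has_sum_SigmaD) (auto intro!: has_sum_finiteI)
qed

text \<open>Nonnegativity excludes cancellation inside the finite inner sums, so the regrouped
  family controls the original one.\<close>

lemma summable_by_total:
  fixes f :: "'n::finite multiset \<times> 'n multiset \<Rightarrow> real"
  assumes "(\<lambda>\<gamma>. \<Sum>\<delta> | \<delta> \<subseteq># \<gamma>. f (\<delta>, \<gamma> - \<delta>)) summable_on UNIV" and nonneg: "\<And>p. 0 \<le> f p"
  shows "f summable_on UNIV"
proof -
  have "(\<lambda>p. norm ((\<lambda>(\<gamma>, \<delta>). f (\<delta>, \<gamma> - \<delta>)) p)) summable_on (SIGMA \<gamma>:UNIV. {\<delta>. \<delta> \<subseteq># \<gamma>})"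
    unfolding Infinite_Sum.abs_summable_on_Sigma_iff using assms by (auto simp: sum_nonneg)
  then have "(\<lambda>(\<gamma>, \<delta>). f (\<delta>, \<gamma> - \<delta>)) summable_on (SIGMA \<gamma>:UNIV. {\<delta>. \<delta> \<subseteq># \<gamma>})"
    by (rule abs_summable_summable)
  then show ?thesis
    by (subst summable_on_reindex_bij_witness[where T = "SIGMA \<gamma>:UNIV. {\<delta>. \<delta> \<subseteq># \<gamma>}" and h = "\<lambda>(\<gamma>, \<delta>). f (\<delta>, \<gamma> - \<delta>)" and j = "\<lambda>(\<delta>, \<epsilon>). (\<delta> + \<epsilon>, \<delta>)" and i = "\<lambda>(\<gamma>, \<delta>). (\<delta>, \<gamma> - \<delta>)"])
       (auto simp: subset_mset.add_diff_inverse)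
qed

section \<open>Convergent power series: recentring and differentiation\<close>

text \<open>A closed cube is used instead of a ball because on it every monomial is bounded by
  \<open>R ^ size \<gamma>\<close>, so a single numerical series dominates the power series at all
  its points, including the corner where the bound is attained.\<close>

definition has_powser :: "(real^'n::finite \<Rightarrow> real) \<Rightarrow> real^'n \<Rightarrow> ('n multiset \<Rightarrow> real) \<Rightarrow> real \<Rightarrow> bool" where
  "has_powser f x0 c R \<longleftrightarrow> R > 0 \<and> (\<lambda>\<gamma>. \<bar>c \<gamma>\<bar> * R ^ size \<gamma>) summable_on UNIV \<and>
     (\<forall>y. (\<forall>i. \<bar>y $ i\<bar> \<le> R) \<longrightarrow> ((\<lambda>\<gamma>. c \<gamma> * mpow (($) y) \<gamma>) has_sum f (x0 + y)) UNIV)"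

lemma powser_summable:
  assumes "(\<lambda>\<gamma>. \<bar>c \<gamma>\<bar> * R ^ size \<gamma>) summable_on UNIV" and "\<And>i. \<bar>y i\<bar> \<le> R"
  shows "(\<lambda>\<gamma>. c \<gamma> * mpow y \<gamma>) summable_on (A :: 'n::finite multiset set)"
proof -
  have R: "0 \<le> R" using assms(2) by (meson abs_ge_zero order_trans)
  have "(\<lambda>\<gamma>. c \<gamma> * mpow y \<gamma>) summable_on UNIV"
    by (rule summable_on_comparison_real[OF assms(1)])
       (use assms R in \<open>auto simp: abs_mult intro!: mult_left_mono abs_mpow_le\<close>)
  then show ?thesis
    using summable_on_subset_banach by blast
qed

lemma has_powserI:
  assumes "R > 0" "(\<lambda>\<gamma>. \<bar>c \<gamma>\<bar> * R ^ size \<gamma>) summable_on UNIV"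
    and "\<And>y. (\<And>i. \<bar>y $ i\<bar> \<le> R) \<Longrightarrow> f (x0 + y) = (\<Sum>\<^sub>\<infinity>\<gamma>. c \<gamma> * mpow (($) y) \<gamma>)"
  shows "has_powser f x0 c R"
  using assms powser_summable[of c R] unfolding has_powser_def
  by (auto simp: summable_iff_has_sum_infsum[symmetric])

lemma powser_summable_mono:
  fixes c :: "'n::finite multiset \<Rightarrow> real"
  assumes "(\<lambda>\<gamma>. \<bar>c \<gamma>\<bar> * R ^ size \<gamma>) summable_on UNIV" "0 \<le> R'" "R' \<le> R"
  shows "(\<lambda>\<gamma>. \<bar>c \<gamma>\<bar> * R' ^ size \<gamma>) summable_on UNIV"
  using assms by (intro summable_on_comparison_real[OF assms(1)]) (auto simp: abs_mult intro!: mult_left_mono power_mono)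

lemma has_powser_mono: "has_powser f x0 c R \<Longrightarrow> 0 < R' \<Longrightarrow> R' \<le> R \<Longrightarrow> has_powser f x0 c R'"
  using powser_summable_mono[of c R R'] unfolding has_powser_def by (meson order.strict_implies_order order_trans)

(* The coefficients of the derivative with respect to the multi-index \<delta>, divided by \<delta>!. *)
definition cshift :: "'n::finite multiset \<Rightarrow> ('n multiset \<Rightarrow> real) \<Rightarrow> 'n multiset \<Rightarrow> real" where
  "cshift \<delta> c \<epsilon> = mfact (\<delta> + \<epsilon>) / (mfact \<delta> * mfact \<epsilon>) * c (\<delta> + \<epsilon>)"

text \<open>By the binomial theorem at R/2 + R/2 the terms with \<delta> + \<epsilon> = \<gamma> add
  up to exactly \<bar>c \<gamma>\<bar> * R ^ size \<gamma>. This is the origin of the halved radii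
  below.\<close>

lemma cshift_summable:
  assumes "(\<lambda>\<gamma>. \<bar>c \<gamma>\<bar> * R ^ size \<gamma>) summable_on UNIV" and R: "0 \<le> R"
  shows "(\<lambda>(\<delta>, \<epsilon>). \<bar>cshift \<delta> c \<epsilon>\<bar> * (R/2) ^ size \<delta> * (R/2) ^ size \<epsilon>) summable_on UNIV"
proof (rule summable_by_total)
  show "(\<lambda>\<gamma>. \<Sum>\<delta> | \<delta> \<subseteq># \<gamma>. case (\<delta>, \<gamma> - \<delta>) of (\<delta>, \<epsilon>) \<Rightarrow>
      \<bar>cshift \<delta> c \<epsilon>\<bar> * (R/2) ^ size \<delta> * (R/2) ^ size \<epsilon>) summable_on UNIV"
  proof -
    have "(\<Sum>\<delta> | \<delta> \<subseteq># \<gamma>. case (\<delta>, \<gamma> - \<delta>) of (\<delta>, \<epsilon>) \<Rightarrow>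
      \<bar>cshift \<delta> c \<epsilon>\<bar> * (R/2) ^ size \<delta> * (R/2) ^ size \<epsilon>) = \<bar>c \<gamma>\<bar> * R ^ size \<gamma>" for \<gamma>
    proof -
      have "(\<Sum>\<delta> | \<delta> \<subseteq># \<gamma>. case (\<delta>, \<gamma> - \<delta>) of (\<delta>, \<epsilon>) \<Rightarrow>
          \<bar>cshift \<delta> c \<epsilon>\<bar> * (R/2) ^ size \<delta> * (R/2) ^ size \<epsilon>)
        = (\<Sum>\<delta> | \<delta> \<subseteq># \<gamma>. \<bar>c \<gamma>\<bar> * (mfact \<gamma> / (mfact \<delta> * mfact (\<gamma> - \<delta>)) * (mpow (\<lambda>_. R/2) \<delta> * mpow (\<lambda>_. R/2) (\<gamma> - \<delta>))))"
        by (rule sum.cong) (auto simp: cshift_def abs_mult abs_of_pos)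
      then show ?thesis
        using mpow_binomial[of "\<lambda>_. R/2" "\<lambda>_. R/2" \<gamma>] by (simp only: sum_distrib_left[symmetric]) simp
    qed
    with assms show ?thesis by simp
  qed
qed (use R in auto)

text \<open>Expand (h + y)^\<gamma> binomially and collect the powers of h. Halving the radius keeps
  h + y inside the original cube and makes the double family absolutely summable, so the order of
  summation may be changed.\<close>

lemma has_powser_recenter:
  fixes f :: "real^'n::finite \<Rightarrow> real"
  assumes "has_powser f x0 c R" and y: "\<And>i. \<bar>y $ i\<bar> \<le> R/2"
  shows "has_powser f (x0 + y) (\<lambda>\<delta>. \<Sum>\<^sub>\<infinity>\<epsilon>. cshift \<delta> c \<epsilon> * mpow (($) y) \<epsilon>) (R/2)"
    and "(\<lambda>\<epsilon>. \<bar>cshift \<delta> c \<epsilon>\<bar> * (R/2) ^ size \<epsilon>) summable_on UNIV"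
proof -
  from assms(1) have R: "R > 0" and sc: "(\<lambda>\<gamma>. \<bar>c \<gamma>\<bar> * R ^ size \<gamma>) summable_on UNIV"
    and hs: "\<And>y. (\<And>i. \<bar>y $ i\<bar> \<le> R) \<Longrightarrow> ((\<lambda>\<gamma>. c \<gamma> * mpow (($) y) \<gamma>) has_sum f (x0 + y)) UNIV"
    by (auto simp: has_powser_def)
  let ?e = "\<lambda>\<delta>. \<Sum>\<^sub>\<infinity>\<epsilon>. cshift \<delta> c \<epsilon> * mpow (($) y) \<epsilon>"
  have S: "(\<lambda>(\<delta>, \<epsilon>). \<bar>cshift \<delta> c \<epsilon>\<bar> * (R/2) ^ size \<delta> * (R/2) ^ size \<epsilon>) summable_on UNIV \<times> UNIV"
    using cshift_summable[OF sc] R by simp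
  show S1: "(\<lambda>\<epsilon>. \<bar>cshift \<delta> c \<epsilon>\<bar> * (R/2) ^ size \<epsilon>) summable_on UNIV" for \<delta>
  proof -
    have "(\<lambda>\<epsilon>. \<bar>cshift \<delta> c \<epsilon>\<bar> * (R/2) ^ size \<delta> * (R/2) ^ size \<epsilon>) summable_on UNIV"
      using summable_on_SigmaD1[OF S, of \<delta>] by simp
    then have "(\<lambda>\<epsilon>. (1 / (R/2) ^ size \<delta>) * (\<bar>cshift \<delta> c \<epsilon>\<bar> * (R/2) ^ size \<delta> * (R/2) ^ size \<epsilon>)) summable_on UNIV"
      by (rule summable_on_cmult_right)
    then show ?thesis using R by simp
  qed
  have T: "(\<lambda>(\<delta>, \<epsilon>). cshift \<delta> c \<epsilon> * (mpow h \<delta> * mpow (($) y) \<epsilon>)) summable_on UNIV \<times> UNIV"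
    if h: "\<And>i. \<bar>h i\<bar> \<le> R/2" for h
  proof (rule summable_on_comparison_real[OF S])
    show "\<bar>case p of (\<delta>, \<epsilon>) \<Rightarrow> cshift \<delta> c \<epsilon> * (mpow h \<delta> * mpow (($) y) \<epsilon>)\<bar>
      \<le> (case p of (\<delta>, \<epsilon>) \<Rightarrow> \<bar>cshift \<delta> c \<epsilon>\<bar> * (R/2) ^ size \<delta> * (R/2) ^ size \<epsilon>)" for p
      using R h y by (cases p) (auto simp: abs_mult mult.assoc simp del: power_divide intro!: mult_left_mono mult_mono abs_mpow_le)
  qed
  have in1: "((\<lambda>\<epsilon>. cshift \<delta> c \<epsilon> * (mpow h \<delta> * mpow (($) y) \<epsilon>)) has_sum ?e \<delta> * mpow h \<delta>) UNIV" for h \<delta>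
  proof -
    have "((\<lambda>\<epsilon>. cshift \<delta> c \<epsilon> * mpow (($) y) \<epsilon>) has_sum ?e \<delta>) UNIV"
      using powser_summable[OF S1, of "($) y"] y by (simp add: summable_iff_has_sum_infsum[symmetric])
    from has_sum_cmult_left[OF this, of "mpow h \<delta>"] show ?thesis by (simp add: mult_ac)
  qed
  have main: "((\<lambda>\<delta>. ?e \<delta> * mpow (($) h) \<delta>) has_sum f (x0 + y + h)) UNIV" if h: "\<And>i. \<bar>h $ i\<bar> \<le> R/2" for h
  proof -
    obtain s where s: "((\<lambda>(\<delta>, \<epsilon>). cshift \<delta> c \<epsilon> * (mpow (($) h) \<delta> * mpow (($) y) \<epsilon>)) has_sum s) (UNIV \<times> UNIV)"
      using T[of "($) h"] h by (auto simp: summable_on_def)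
    have "((\<lambda>\<gamma>. \<Sum>\<delta> | \<delta> \<subseteq># \<gamma>. cshift \<delta> c (\<gamma> - \<delta>) * (mpow (($) h) \<delta> * mpow (($) y) (\<gamma> - \<delta>))) has_sum s) UNIV"
      using has_sum_by_total[of "\<lambda>(\<delta>, \<epsilon>). cshift \<delta> c \<epsilon> * (mpow (($) h) \<delta> * mpow (($) y) \<epsilon>)" s] s by simp
    moreover have "(\<Sum>\<delta> | \<delta> \<subseteq># \<gamma>. cshift \<delta> c (\<gamma> - \<delta>) * (mpow (($) h) \<delta> * mpow (($) y) (\<gamma> - \<delta>))) = c \<gamma> * mpow (($) (h + y)) \<gamma>" for \<gamma>
    proof -
      have eq: "mpow (($) (h + y)) \<gamma> = mpow (\<lambda>i. h $ i + y $ i) \<gamma>" by (simp add: mpow_def)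
      show ?thesis
        unfolding eq mpow_binomial sum_distrib_left by (auto simp: cshift_def intro!: sum.cong)
    qed
    ultimately have "((\<lambda>\<gamma>. c \<gamma> * mpow (($) (h + y)) \<gamma>) has_sum s) UNIV" by simp
    moreover have "\<bar>(h + y) $ i\<bar> \<le> R" for i using h[of i] y[of i] by simp
    ultimately have "s = f (x0 + (h + y))"
      using hs has_sum_unique by blast
    with has_sum_SigmaD[OF s, of "\<lambda>\<delta>. ?e \<delta> * mpow (($) h) \<delta>"] in1 show ?thesis
      by (simp add: add_ac)
  qed
  \<comment> \<open>At the corner h = (R/2, ..., R/2) each monomial equals its bound, and a summable
    real family is absolutely summable.\<close>
  have "(\<lambda>\<delta>. ?e \<delta> * (R/2) ^ size \<delta>) summable_on UNIV"
  proof -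
    have "\<bar>(\<chi> i. R/2) $ i\<bar> \<le> R/2" for i :: 'n using R by simp
    moreover have "mpow (($) (\<chi> i. R/2)) \<delta> = (R/2) ^ size \<delta>" for \<delta> :: "'n multiset"
      by (simp add: mpow_def)
    ultimately show ?thesis
      using has_sum_imp_summable[OF main[of "\<chi> i. R/2"]] by simp
  qed
  then have "(\<lambda>\<delta>. \<bar>?e \<delta>\<bar> * (R/2) ^ size \<delta>) summable_on UNIV"
    unfolding summable_on_iff_abs_summable_on_real[of "\<lambda>\<delta>. ?e \<delta> * (R/2) ^ size \<delta>"]
    using R by (simp add: abs_mult)
  with main R show "has_powser f (x0 + y) ?e (R/2)"
    by (auto simp: has_powser_def)
qed

lemma mpow_zero: "(\<And>i. y i = 0) \<Longrightarrow> mpow y \<gamma> = (if \<gamma> = {#} then 1 else 0)"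
  by (cases \<gamma>) auto

lemma has_powser_center:
  assumes "has_powser f x0 c R"
  shows "f x0 = c {#}"
proof -
  from assms have "((\<lambda>\<gamma>. c \<gamma> * mpow (($) 0) \<gamma>) has_sum f (x0 + 0)) UNIV"
    unfolding has_powser_def by (metis abs_zero less_eq_real_def zero_index)
  moreover have "((\<lambda>\<gamma>. c \<gamma> * mpow (($) 0) \<gamma>) has_sum c {#}) UNIV"
    by (rule has_sum_finite_neutralI[of "{{#}}"]) (auto simp: mpow_zero)
  ultimately show ?thesis using has_sum_unique by fastforce
qed

text \<open>Along the i-th axis all other monomials of degree one vanish, so what remains after the
  constant and the linear term starts in degree two and is at most t^2 S / R^2. Only the centre is
  treated; other points are reached by recentring.\<close>

lemma has_powser_DERIV:
  fixes f :: "real^'n::finite \<Rightarrow> real"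
  assumes "has_powser f x0 c R"
  shows "((\<lambda>t. f (x0 + t *\<^sub>R axis i 1)) has_real_derivative c {#i#}) (at 0)"
proof -
  from assms have R: "R > 0" and sc: "(\<lambda>\<gamma>. \<bar>c \<gamma>\<bar> * R ^ size \<gamma>) summable_on UNIV"
    and hs: "\<And>y. (\<And>i. \<bar>y $ i\<bar> \<le> R) \<Longrightarrow> ((\<lambda>\<gamma>. c \<gamma> * mpow (($) y) \<gamma>) has_sum f (x0 + y)) UNIV"
    by (auto simp: has_powser_def)
  define S where "S = (\<Sum>\<^sub>\<infinity>\<gamma>. \<bar>c \<gamma>\<bar> * R ^ size \<gamma>)"
  have bound: "\<bar>f (x0 + t *\<^sub>R axis i 1) - f x0 - t * c {#i#}\<bar> \<le> t\<^sup>2 * (S / R\<^sup>2)" if t: "\<bar>t\<bar> \<le> R" for t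
  proof -
    let ?y = "t *\<^sub>R axis i 1 :: real^'n"
    let ?g = "\<lambda>\<gamma>. c \<gamma> * mpow (($) ?y) \<gamma>"
    let ?A = "{{#}, {#i#}}"
    have y: "\<bar>?y $ j\<bar> \<le> \<bar>t\<bar>" for j by (auto simp: axis_def)
    have "(?g has_sum f (x0 + ?y)) UNIV" using hs y t by (meson order_trans)
    then have "((\<lambda>\<gamma>. if \<gamma> \<in> ?A then 0 else ?g \<gamma>) has_sum (f (x0 + ?y) - sum ?g ?A)) UNIV"
    proof -
      assume g: "(?g has_sum f (x0 + ?y)) UNIV"
      have "((\<lambda>\<gamma>. if \<gamma> \<in> ?A then - ?g \<gamma> else 0) has_sum (- sum ?g ?A)) UNIV"
        by (rule has_sum_finite_neutralI[of ?A]) (auto simp: sum_negf)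
      note has_sum_add[OF g this]
      also have "(\<lambda>\<gamma>. ?g \<gamma> + (if \<gamma> \<in> ?A then - ?g \<gamma> else 0)) = (\<lambda>\<gamma>. if \<gamma> \<in> ?A then 0 else ?g \<gamma>)"
        by (rule ext) simp
      finally show ?thesis by (simp only: diff_conv_add_uminus)
    qed
    moreover have "sum ?g ?A = f x0 + t * c {#i#}"
      by (simp add: has_powser_center[OF assms] axis_def)
    ultimately have rem: "((\<lambda>\<gamma>. if \<gamma> \<in> ?A then 0 else ?g \<gamma>) has_sum (f (x0 + ?y) - (f x0 + t * c {#i#}))) UNIV"
      by simp
    have le: "\<bar>if \<gamma> \<in> ?A then 0 else ?g \<gamma>\<bar> \<le> t\<^sup>2 / R\<^sup>2 * (\<bar>c \<gamma>\<bar> * R ^ size \<gamma>)" for \<gamma>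
    proof (cases "\<gamma> \<in> ?A")
      case False
      show ?thesis
      proof (cases "size \<gamma> = 1")
        case True
        then obtain j where "\<gamma> = {#j#}" using size_1_singleton_mset by blast
        with False have "mpow (($) ?y) \<gamma> = 0" by (auto simp: axis_def)
        then show ?thesis using R by auto
      next
        case n1: False
        with False have "size \<gamma> \<ge> 2"
          by (metis One_nat_def Suc_1 insertI1 le_SucE linorder_le_cases not_less_eq_eq size_eq_0_iff_empty le_zero_eq)
        then obtain m where m: "size \<gamma> = m + 2" by (metis add.commute le_Suc_ex)
        have "\<bar>mpow (($) ?y) \<gamma>\<bar> \<le> \<bar>t\<bar> ^ size \<gamma>" by (rule abs_mpow_le[OF y])
        also have "\<dots> = t\<^sup>2 * \<bar>t\<bar> ^ m" by (simp add: m power_add power2_eq_square)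
        also have "\<dots> \<le> t\<^sup>2 * R ^ m" using t by (intro mult_left_mono power_mono) auto
        also have "\<dots> = t\<^sup>2 / R\<^sup>2 * R ^ size \<gamma>" using R by (simp add: m power_add power2_eq_square)
        finally have "\<bar>c \<gamma>\<bar> * \<bar>mpow (($) ?y) \<gamma>\<bar> \<le> \<bar>c \<gamma>\<bar> * (t\<^sup>2 / R\<^sup>2 * R ^ size \<gamma>)" by (rule mult_left_mono) simp
        with False show ?thesis by (simp add: abs_mult mult_ac)
      qed
    qed (use R in auto)
    have "((\<lambda>\<gamma>. t\<^sup>2 / R\<^sup>2 * (\<bar>c \<gamma>\<bar> * R ^ size \<gamma>)) has_sum t\<^sup>2 / R\<^sup>2 * S) UNIV"
      unfolding S_def by (intro has_sum_cmult_right) (use sc in simp)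
    from norm_infsum_le[OF rem this] le
    show ?thesis by (simp add: algebra_simps)
  qed
  show ?thesis
    unfolding has_field_derivative_iff
  proof (rule LIM_zero_cancel)
    let ?q = "\<lambda>t. (f (x0 + t *\<^sub>R axis i 1) - f (x0 + 0 *\<^sub>R axis i 1)) / (t - 0) - c {#i#}"
    have lim: "((\<lambda>t. \<bar>t\<bar> * (S / R\<^sup>2)) \<longlongrightarrow> 0) (at 0)"
      by (rule tendsto_eq_intros refl | simp)+
    have "\<forall>\<^sub>F t in at 0. norm (?q t) \<le> \<bar>t\<bar> * (S / R\<^sup>2)"
      unfolding eventually_at
    proof (intro exI[of _ R] conjI R ballI impI)
      fix t :: real assume "t \<noteq> 0 \<and> dist t 0 < R"
      then have t: "t \<noteq> 0" "\<bar>t\<bar> \<le> R" by (auto simp: dist_real_def)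
      have "?q t = (f (x0 + t *\<^sub>R axis i 1) - f x0 - t * c {#i#}) / t"
        using t(1) by (simp add: field_simps)
      then have "norm (?q t) = \<bar>f (x0 + t *\<^sub>R axis i 1) - f x0 - t * c {#i#}\<bar> / \<bar>t\<bar>" by simp
      also have "\<dots> \<le> t\<^sup>2 * (S / R\<^sup>2) / \<bar>t\<bar>" by (intro divide_right_mono bound t) simp
      also have "\<dots> = \<bar>t\<bar> * (S / R\<^sup>2)"
      proof -
        have "t\<^sup>2 * (S / R\<^sup>2) / \<bar>t\<bar> = (t\<^sup>2 / \<bar>t\<bar>) * (S / R\<^sup>2)" by simp
        also have "t\<^sup>2 / \<bar>t\<bar> = \<bar>t\<bar>" using t(1) by (simp add: power2_eq_square abs_if)
        finally show ?thesis .
      qed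
      finally show "norm (?q t) \<le> \<bar>t\<bar> * (S / R\<^sup>2)" .
    qed
    then show "(?q \<longlongrightarrow> 0) (at 0)" by (rule Lim_null_comparison[OF _ lim])
  qed
qed

text \<open>Unlike \<open>cshift\<close> this has no division by \<alpha>!, so that
  \<open>cderiv \<alpha>\<close> after \<open>cderiv \<beta>\<close> is
  \<open>cderiv (\<alpha> + \<beta>)\<close>.\<close>

definition cderiv :: "'n::finite multiset \<Rightarrow> ('n multiset \<Rightarrow> real) \<Rightarrow> 'n multiset \<Rightarrow> real" where
  "cderiv \<alpha> c \<epsilon> = mfact (\<alpha> + \<epsilon>) / mfact \<epsilon> * c (\<alpha> + \<epsilon>)"

text \<open>The derivative at x0 + y is the linear coefficient of the series recentred there, and
  that coefficient is by construction a power series in y.\<close>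

lemma has_powser_partial_deriv:
  assumes "has_powser f x0 c R"
  shows "has_powser (partial_deriv i f) x0 (cderiv {#i#} c) (R/2)"
proof (rule has_powserI)
  show R: "R/2 > 0" using assms by (simp add: has_powser_def)
  have eq: "cderiv {#i#} c = cshift {#i#} c" by (auto simp: cshift_def cderiv_def mfact_add_mset)
  show "(\<lambda>\<gamma>. \<bar>cderiv {#i#} c \<gamma>\<bar> * (R/2) ^ size \<gamma>) summable_on UNIV"
    unfolding eq by (rule has_powser_recenter(2)[OF assms, of 0]) (use R in simp)
  show "partial_deriv i f (x0 + y) = (\<Sum>\<^sub>\<infinity>\<gamma>. cderiv {#i#} c \<gamma> * mpow (($) y) \<gamma>)" if y: "\<And>i. \<bar>y $ i\<bar> \<le> R/2" for y
    using DERIV_imp_deriv[OF has_powser_DERIV[OF has_powser_recenter(1)[OF assms y], of i]]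
    by (simp add: partial_deriv_def eq)
qed

lemma has_powser_partial_derivs:
  "has_powser f x0 c R \<Longrightarrow> has_powser (partial_derivs is f) x0 (cderiv (mset is) c) (R / 2 ^ length is)"
proof (induction "is")
  case Nil
  then show ?case by (simp add: partial_derivs_def cderiv_def)
next
  case (Cons i "is")
  have "cderiv {#i#} (cderiv (mset is) c) = cderiv (mset (i # is)) c"
    by (rule ext) (simp add: cderiv_def)
  with has_powser_partial_deriv[OF Cons.IH[OF Cons.prems], of i] show ?case
    by (simp add: partial_derivs_def mult.commute)
qed

lemma has_sum_finite_sum:
  fixes h :: "'i \<Rightarrow> 'a \<Rightarrow> real"
  assumes "\<And>k. k \<in> K \<Longrightarrow> (h k has_sum H k) A"
  shows "((\<lambda>x. \<Sum>k\<in>K. h k x) has_sum (\<Sum>k\<in>K. H k)) A"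
  using assms by (induction K rule: infinite_finite_induct) (auto intro: has_sum_add)

lemma has_sum_cauchy_product:
  fixes a b :: "'n::finite multiset \<Rightarrow> real"
  assumes f: "((\<lambda>\<gamma>. a \<gamma> * mpow y \<gamma>) has_sum F) UNIV"
    and g: "((\<lambda>\<gamma>. b \<gamma> * mpow y \<gamma>) has_sum G) UNIV"
  shows "((\<lambda>\<gamma>. (\<Sum>\<delta> | \<delta> \<subseteq># \<gamma>. a \<delta> * b (\<gamma> - \<delta>)) * mpow y \<gamma>) has_sum F * G) UNIV"
proof -
  let ?p = "\<lambda>(\<delta>, \<epsilon>). (a \<delta> * mpow y \<delta>) * (b \<epsilon> * mpow y \<epsilon>)"
  have af: "(\<lambda>\<gamma>. norm (a \<gamma> * mpow y \<gamma>)) summable_on UNIV" and ag: "(\<lambda>\<gamma>. norm (b \<gamma> * mpow y \<gamma>)) summable_on UNIV"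
    using has_sum_imp_summable[OF f, THEN iffD1[OF summable_on_iff_abs_summable_on_real]]
      has_sum_imp_summable[OF g, THEN iffD1[OF summable_on_iff_abs_summable_on_real]] by simp_all
  have "(\<lambda>p. norm (?p p)) summable_on UNIV \<times> UNIV"
    unfolding Infinite_Sum.abs_summable_on_Sigma_iff
  proof (intro conjI ballI)
    show "(\<lambda>\<epsilon>. norm (?p (\<delta>, \<epsilon>))) summable_on UNIV" for \<delta>
      using summable_on_cmult_right[OF ag, of "norm (a \<delta> * mpow y \<delta>)"] by (simp only: prod.case norm_mult)
    have "(\<Sum>\<^sub>\<infinity>\<epsilon>. norm (?p (\<delta>, \<epsilon>))) = norm (a \<delta> * mpow y \<delta>) * (\<Sum>\<^sub>\<infinity>\<epsilon>. norm (b \<epsilon> * mpow y \<epsilon>))" for \<delta>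
      by (simp only: infsum_cmult_right'[symmetric] prod.case norm_mult)
    then show "(\<lambda>\<delta>. norm (\<Sum>\<^sub>\<infinity>\<epsilon>. norm (?p (\<delta>, \<epsilon>)))) summable_on UNIV"
      using summable_on_cmult_left[OF af, of "norm (\<Sum>\<^sub>\<infinity>\<epsilon>. norm (b \<epsilon> * mpow y \<epsilon>))"]
      by (simp only: norm_mult real_norm_def abs_idempotent abs_mult)
  qed
  then have "?p summable_on UNIV \<times> UNIV" by (rule abs_summable_summable)
  then have "(?p has_sum F * G) (UNIV \<times> UNIV)"
    by (intro has_sum_SigmaI[where g = "\<lambda>\<delta>. (a \<delta> * mpow y \<delta>) * G"])
       (auto intro!: has_sum_cmult_right has_sum_cmult_left f g)
  then have "((\<lambda>\<gamma>. \<Sum>\<delta> | \<delta> \<subseteq># \<gamma>. ?p (\<delta>, \<gamma> - \<delta>)) has_sum F * G) UNIV"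
    by (intro has_sum_by_total) simp
  moreover have "(\<Sum>\<delta> | \<delta> \<subseteq># \<gamma>. ?p (\<delta>, \<gamma> - \<delta>)) = (\<Sum>\<delta> | \<delta> \<subseteq># \<gamma>. a \<delta> * b (\<gamma> - \<delta>)) * mpow y \<gamma>" for \<gamma>
    unfolding sum_distrib_right
  proof (intro sum.cong refl)
    fix \<delta> assume "\<delta> \<in> {\<delta>. \<delta> \<subseteq># \<gamma>}"
    then have "mpow y \<gamma> = mpow y \<delta> * mpow y (\<gamma> - \<delta>)" by (simp flip: mpow_union)
    then show "?p (\<delta>, \<gamma> - \<delta>) = a \<delta> * b (\<gamma> - \<delta>) * mpow y \<gamma>" by simp
  qed
  ultimately show ?thesis by simp
qed

subsection \<open>Real analytic functions\<close>

text \<open>Translates between multisets of basis vectors, as in \<open>real_analytic_on\<close>,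
  and multisets of indices. The embedding e need not reach the whole basis, so that functions of
  some of the coordinates of a product are covered too.\<close>

lemma has_sum_reindex_basis:
  fixes e :: "'n \<Rightarrow> 'b::euclidean_space"
  assumes "inj e"
  shows "((\<lambda>\<alpha>. C \<alpha> * (\<Prod>b\<in>#\<alpha>. z \<bullet> b)) has_sum s) {\<alpha>. set_mset \<alpha> \<subseteq> range e} \<longleftrightarrow>
         ((\<lambda>\<gamma>. C (image_mset e \<gamma>) * mpow (\<lambda>i. z \<bullet> e i) \<gamma>) has_sum s) (UNIV :: 'n multiset set)"
proof -
  have "bij_betw (image_mset e) UNIV {\<alpha>. set_mset \<alpha> \<subseteq> range e}"
  proof (rule bij_betw_byWitness[where f' = "image_mset (inv e)"])
    show "\<forall>\<gamma>\<in>UNIV. image_mset (inv e) (image_mset e \<gamma>) = \<gamma>"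
      using assms by (simp add: multiset.map_comp)
    show "\<forall>\<alpha>\<in>{\<alpha>. set_mset \<alpha> \<subseteq> range e}. image_mset e (image_mset (inv e) \<alpha>) = \<alpha>"
    proof
      fix \<alpha> assume "\<alpha> \<in> {\<alpha>. set_mset \<alpha> \<subseteq> range e}"
      then have "image_mset (e \<circ> inv e) \<alpha> = image_mset id \<alpha>"
        by (intro image_mset_cong) (auto simp: f_inv_into_f subset_iff)
      then show "image_mset e (image_mset (inv e) \<alpha>) = \<alpha>" by (simp add: multiset.map_comp)
    qed
  qed auto
  from has_sum_reindex_bij_betw[OF this, of "\<lambda>\<alpha>. C \<alpha> * (\<Prod>b\<in>#\<alpha>. z \<bullet> b)" s] show ?thesis
    by (simp add: mpow_def multiset.map_comp o_def)
qed

lemma inj_axis_1: "inj (\<lambda>i. axis i (1::real))"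
  by (auto simp: inj_def axis_eq_axis)

lemma range_axis_1: "range (\<lambda>i. axis i (1::real)) = Basis"
  by (auto simp: Basis_vec_def)

lemma real_analytic_on_imp_has_powser:
  fixes f :: "real^'n::finite \<Rightarrow> real"
  assumes "real_analytic_on f S" "x0 \<in> S"
  shows "\<exists>c R. has_powser f x0 c R"
proof -
  from assms obtain r C where r: "r > 0" and C: "\<And>x. x \<in> ball x0 r \<Longrightarrow>
      ((\<lambda>\<alpha>. C \<alpha> * (\<Prod>b\<in>#\<alpha>. (x - x0) \<bullet> b)) has_sum f x) {\<alpha>. set_mset \<alpha> \<subseteq> Basis}"
    unfolding real_analytic_on_def by meson
  define c where "c = (\<lambda>\<gamma>. C (image_mset (\<lambda>i. axis i 1) \<gamma>))"
  \<comment> \<open>With this R the l^1 norm of y is at most r/2, so the closed cube lies inside the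
    ball; absolute summability is then read off at its corner.\<close>
  define R where "R = r / (2 * CARD('n))"
  have R: "R > 0" using r by (simp add: R_def)
  have hs: "((\<lambda>\<gamma>. c \<gamma> * mpow (($) y) \<gamma>) has_sum f (x0 + y)) UNIV" if y: "\<And>i. \<bar>y $ i\<bar> \<le> R" for y
  proof -
    have "norm y \<le> (\<Sum>i\<in>UNIV. \<bar>y $ i\<bar>)" by (rule norm_le_l1_cart)
    also have "\<dots> \<le> (\<Sum>i\<in>(UNIV::'n set). R)" by (intro sum_mono y)
    also have "\<dots> < r" using r by (simp add: R_def)
    finally have "x0 + y \<in> ball x0 r" by (simp add: dist_norm)
    from C[OF this] show ?thesis
      unfolding range_axis_1[symmetric] has_sum_reindex_basis[OF inj_axis_1] c_def
      by (simp add: inner_axis mpow_def)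
  qed
  have "(\<lambda>\<gamma>. c \<gamma> * R ^ size \<gamma>) summable_on UNIV"
    using has_sum_imp_summable[OF hs[of "\<chi> i. R"]] R by (simp add: mpow_def)
  then have "(\<lambda>\<gamma>. \<bar>c \<gamma>\<bar> * R ^ size \<gamma>) summable_on UNIV"
    unfolding summable_on_iff_abs_summable_on_real[of "\<lambda>\<gamma>. c \<gamma> * R ^ size \<gamma>"]
    using R by (simp add: abs_mult)
  with R hs show ?thesis by (auto simp: has_powser_def)
qed

text \<open>Serves with p the identity, and with p the projection of a product to its first
  factor.\<close>

lemma real_analytic_on_pullback:
  fixes p :: "'b::euclidean_space \<Rightarrow> real^'n::finite"
  assumes e: "inj e" "range e \<subseteq> Basis" and p: "\<And>z i. p z $ i = z \<bullet> e i"
    and f: "\<And>z. z \<in> S \<Longrightarrow> \<exists>c R. has_powser f (p z) c R"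
  shows "real_analytic_on (\<lambda>z. f (p z)) S"
  unfolding real_analytic_on_def
proof
  fix z0 assume "z0 \<in> S"
  from f[OF this] obtain c R where cR: "has_powser f (p z0) c R" by blast
  then have R: "R > 0" by (simp add: has_powser_def)
  \<comment> \<open>A monomial that involves a basis vector outside \<open>range e\<close> gets
    coefficient 0, since f (p z) is constant in that direction.\<close>
  define C where "C = (\<lambda>\<alpha>. if set_mset \<alpha> \<subseteq> range e then c (image_mset (inv e) \<alpha>) else 0)"
  have "((\<lambda>\<alpha>. C \<alpha> * (\<Prod>b\<in>#\<alpha>. (z - z0) \<bullet> b)) has_sum f (p z)) {\<alpha>. set_mset \<alpha> \<subseteq> Basis}" if "z \<in> ball z0 R" for z
  proof -
    have y: "(p z - p z0) $ i = (z - z0) \<bullet> e i" for i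
      by (simp add: p inner_diff_left)
    have "\<bar>(p z - p z0) $ i\<bar> \<le> R" for i
    proof -
      have "\<bar>(z - z0) \<bullet> e i\<bar> \<le> norm (z - z0)" using e(2) by (intro Basis_le_norm) auto
      then show ?thesis unfolding y using that by (simp add: dist_norm norm_minus_commute)
    qed
    then have "((\<lambda>\<gamma>. c \<gamma> * mpow (($) (p z - p z0)) \<gamma>) has_sum f (p z0 + (p z - p z0))) UNIV"
      using cR unfolding has_powser_def by blast
    moreover have "C (image_mset e \<gamma>) = c \<gamma>" for \<gamma>
      using e(1) by (auto simp: C_def multiset.map_comp)
    moreover have "mpow (($) (p z - p z0)) = mpow (\<lambda>i. (z - z0) \<bullet> e i)"
      unfolding mpow_def y ..
    ultimately have "((\<lambda>\<alpha>. C \<alpha> * (\<Prod>b\<in>#\<alpha>. (z - z0) \<bullet> b)) has_sum f (p z)) {\<alpha>. set_mset \<alpha> \<subseteq> range e}"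
      unfolding has_sum_reindex_basis[OF e(1)] by simp
    then show ?thesis
    proof (rule has_sum_cong_neutral[THEN iffD1, rotated -1])
      fix \<alpha> assume "\<alpha> \<in> {\<alpha>. set_mset \<alpha> \<subseteq> range e} - {\<alpha>. set_mset \<alpha> \<subseteq> Basis}"
      with e(2) have False by blast
      then show "C \<alpha> * (\<Prod>b\<in>#\<alpha>. (z - z0) \<bullet> b) = 0" ..
    qed (auto simp: C_def)
  qed
  with R show "\<exists>r>0. \<exists>c. \<forall>x\<in>ball z0 r. ((\<lambda>\<alpha>. c \<alpha> * (\<Prod>b\<in>#\<alpha>. (x - z0) \<bullet> b)) has_sum f (p x)) {\<alpha>. set_mset \<alpha> \<subseteq> Basis}"
    by blast
qed

lemma real_analytic_on_iff_has_powser: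
  "real_analytic_on f S \<longleftrightarrow> (\<forall>x\<in>S. \<exists>c R. has_powser f x c R)" for f :: "real^'n::finite \<Rightarrow> real"
proof
  show "real_analytic_on f S" if "\<forall>x\<in>S. \<exists>c R. has_powser f x c R"
    by (rule real_analytic_on_pullback[where e = "\<lambda>i. axis i 1" and p = "\<lambda>x. x"])
       (use that in \<open>auto simp: inner_axis inj_axis_1 range_axis_1\<close>)
qed (auto intro: real_analytic_on_imp_has_powser)

section \<open>Closure properties of real analytic functions\<close>

lemma real_analytic_on_partial_deriv:
  "real_analytic_on f S \<Longrightarrow> real_analytic_on (partial_deriv i f) S"
  unfolding real_analytic_on_iff_has_powser using has_powser_partial_deriv by blast

lemma has_powser_add:
  assumes "has_powser f x0 a R" "has_powser g x0 b R"
  shows "has_powser (\<lambda>x. f x + g x) x0 (\<lambda>\<gamma>. a \<gamma> + b \<gamma>) R"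
proof -
  have "(\<lambda>\<gamma>. \<bar>a \<gamma>\<bar> * R ^ size \<gamma> + \<bar>b \<gamma>\<bar> * R ^ size \<gamma>) summable_on UNIV"
    using assms by (intro summable_on_add) (auto simp: has_powser_def)
  then have "(\<lambda>\<gamma>. \<bar>a \<gamma> + b \<gamma>\<bar> * R ^ size \<gamma>) summable_on UNIV"
    using assms by (rule_tac summable_on_comparison_real)
      (auto simp: abs_mult has_powser_def distrib_right[symmetric] intro!: mult_right_mono)
  with assms show ?thesis
    by (auto simp: has_powser_def distrib_right intro: has_sum_add)
qed

lemma real_analytic_on_add:
  fixes f g :: "real^'n::finite \<Rightarrow> real"
  assumes "real_analytic_on f S" "real_analytic_on g S"
  shows "real_analytic_on (\<lambda>x. f x + g x) S"
  unfolding real_analytic_on_iff_has_powser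
proof
  fix x assume "x \<in> S"
  with assms obtain a R b Q where "has_powser f x a R" "has_powser g x b Q"
    unfolding real_analytic_on_iff_has_powser by blast
  moreover from this have "R > 0" "Q > 0" by (auto simp: has_powser_def)
  ultimately have "has_powser f x a (min R Q)" "has_powser g x b (min R Q)"
    by (auto intro: has_powser_mono)
  from has_powser_add[OF this] show "\<exists>c R. has_powser (\<lambda>x. f x + g x) x c R" by blast
qed

lemma has_powser_cmult:
  assumes "has_powser f x0 a R"
  shows "has_powser (\<lambda>x. k * f x) x0 (\<lambda>\<gamma>. k * a \<gamma>) R"
  using assms summable_on_cmult_right[of "\<lambda>\<gamma>. \<bar>a \<gamma>\<bar> * R ^ size \<gamma>" UNIV "\<bar>k\<bar>"]
  by (auto simp: has_powser_def abs_mult mult.assoc intro: has_sum_cmult_right)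

lemma real_analytic_on_cmult:
  "real_analytic_on f S \<Longrightarrow> real_analytic_on (\<lambda>x. k * f x) S" for f :: "real^'n::finite \<Rightarrow> real"
  unfolding real_analytic_on_iff_has_powser using has_powser_cmult by blast

lemma has_powser_0: "R > 0 \<Longrightarrow> has_powser (\<lambda>_. 0) x0 (\<lambda>_. 0) R"
  by (simp add: has_powser_def)

lemma real_analytic_on_0: "real_analytic_on (\<lambda>_. 0) S" for S :: "(real^'n::finite) set"
  unfolding real_analytic_on_iff_has_powser using has_powser_0 zero_less_one by blast

lemma real_analytic_on_sum:
  fixes f :: "'i \<Rightarrow> real^'n::finite \<Rightarrow> real"
  shows "(\<And>k. k \<in> K \<Longrightarrow> real_analytic_on (f k) S) \<Longrightarrow> real_analytic_on (\<lambda>x. \<Sum>k\<in>K. f k x) S"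
  by (induction K rule: infinite_finite_induct) (auto intro: real_analytic_on_add real_analytic_on_0)

section \<open>The identity theorem\<close>

text \<open>On the line t \<mapsto> z + t h the homogeneous parts P k are the coefficients of a
  power series in one variable. It vanishes near t = 0, so isolation of zeros forces all of them to
  be 0, and t = 1 gives the claim. The conclusion holds on the whole cube of convergence, which lets
  vanishing propagate.\<close>

lemma has_powser_vanishing:
  fixes f :: "real^'n::finite \<Rightarrow> real"
  assumes "has_powser f z c R" and zero: "\<forall>\<^sub>F x in nhds z. f x = 0" and h: "\<And>i. \<bar>h $ i\<bar> \<le> R"
  shows "f (z + h) = 0"
proof -
  define P where "P k = (\<Sum>\<gamma> | size \<gamma> = k. c \<gamma> * mpow (($) h) \<gamma>)" for k
  have fin: "finite {\<gamma> :: 'n multiset. size \<gamma> = k}" for k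
    by (rule finite_subset[OF _ finite_size_le[of k]]) auto
  have sums: "(\<lambda>k. P k * t ^ k) sums f (z + t *\<^sub>R h)" if t: "\<bar>t\<bar> \<le> 1" for t
  proof -
    have "\<bar>(t *\<^sub>R h) $ i\<bar> \<le> R" for i
      using mult_mono[OF t h[of i]] by (simp add: abs_mult)
    then have hs: "((\<lambda>\<gamma>. c \<gamma> * mpow (($) (t *\<^sub>R h)) \<gamma>) has_sum f (z + t *\<^sub>R h)) UNIV"
      using assms(1) unfolding has_powser_def by blast
    have "mpow (($) (t *\<^sub>R h)) \<gamma> = t ^ size \<gamma> * mpow (($) h) \<gamma>" for \<gamma>
      using mpow_scale[of t "($) h" \<gamma>] by (simp add: mpow_def)
    with hs have "((\<lambda>\<gamma>. c \<gamma> * (t ^ size \<gamma> * mpow (($) h) \<gamma>)) has_sum f (z + t *\<^sub>R h)) UNIV" by simp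
    then have "((\<lambda>(k, \<gamma>). c \<gamma> * (t ^ k * mpow (($) h) \<gamma>)) has_sum f (z + t *\<^sub>R h)) (SIGMA k:UNIV. {\<gamma>. size \<gamma> = k})"
      by (subst has_sum_reindex_bij_witness[where T = UNIV and j = snd and i = "\<lambda>\<gamma>. (size \<gamma>, \<gamma>)" and h = "\<lambda>\<gamma>. c \<gamma> * (t ^ size \<gamma> * mpow (($) h) \<gamma>)"]) auto
    then have "((\<lambda>k. P k * t ^ k) has_sum f (z + t *\<^sub>R h)) UNIV"
      by (rule has_sum_SigmaD) (auto simp: P_def fin sum_distrib_left sum_distrib_right mult_ac intro!: has_sum_finiteI)
    then show ?thesis by (rule has_sum_imp_sums)
  qed
  have "P k = 0" for k
  proof (rule ccontr)
    assume P: "P k \<noteq> 0"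
    have z0: "f z = 0" using zero by (rule eventually_nhds_x_imp_x)
    then have "P 0 = 0"
      using sums[of 0] by (simp add: powser_sums_zero_iff)
    with P have k: "k > 0" by (cases k) auto
    obtain s where s: "0 < s" "\<And>t. t \<in> cball 0 s - {0} \<Longrightarrow> f (z + t *\<^sub>R h) \<noteq> 0"
    proof (rule powser_0_nonzero[where r = 1 and a = P and \<xi> = 0 and f = "\<lambda>t. f (z + t *\<^sub>R h)" and m = k])
      show "(\<lambda>n. P n * (x - 0) ^ n) sums f (z + x *\<^sub>R h)" if "norm (x - 0) < 1" for x
        using sums[of x] that by simp
    qed (use z0 k P in auto)
    have "((\<lambda>t. z + t *\<^sub>R h) \<longlongrightarrow> z) (at 0)"
      by (rule tendsto_eq_intros refl | simp)+
    from filterlim_iff[THEN iffD1, OF this, rule_format, OF zero]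
    have "\<forall>\<^sub>F t in at 0. f (z + t *\<^sub>R h) = 0" .
    then obtain d where d: "d > 0" "\<And>t. t \<noteq> 0 \<Longrightarrow> \<bar>t\<bar> < d \<Longrightarrow> f (z + t *\<^sub>R h) = 0"
      unfolding eventually_at by (auto simp: dist_real_def)
    define t where "t = min s d / 2"
    have "t > 0" "t \<le> s" "t < d" using d(1) s(1) by (auto simp: t_def)
    with d(2)[of t] s(2)[of t] show False by auto
  qed
  then show ?thesis using sums[of 1] sums_unique2[OF _ sums_zero] by simp
qed

text \<open>Otherwise the interior Z of the zero set meets \<Omega>. Since vanishing propagates
  through cubes of convergence, Z is closed relative to \<Omega>, and connectedness puts x1 into
  Z.\<close>

lemma real_analytic_on_nonzero_dense:
  fixes f :: "real^'n::finite \<Rightarrow> real"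
  assumes "open \<Omega>" "connected \<Omega>" "real_analytic_on f \<Omega>" "x1 \<in> \<Omega>" "f x1 \<noteq> 0"
  shows "\<Omega> \<subseteq> closure {x \<in> \<Omega>. f x \<noteq> 0}"
proof (rule ccontr)
  assume "\<not> ?thesis"
  then obtain w where w: "w \<in> \<Omega>" "w \<notin> closure {x \<in> \<Omega>. f x \<noteq> 0}" by blast
  define Z where "Z = interior {x. f x = 0}"
  have "\<Omega> \<inter> - closure {x \<in> \<Omega>. f x \<noteq> 0} \<subseteq> Z"
    unfolding Z_def using assms(1) closure_subset[of "{x \<in> \<Omega>. f x \<noteq> 0}"]
    by (intro interior_maximal) (auto intro: open_Int)
  with w have wZ: "w \<in> Z \<inter> \<Omega>" by auto
  have cl: "x \<in> Z" if x: "x \<in> \<Omega>" "x \<in> closure Z" for x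
  proof -
    from assms(3) x(1) obtain c R where cR: "has_powser f x c R"
      unfolding real_analytic_on_iff_has_powser by blast
    then have R: "R > 0" by (simp add: has_powser_def)
    \<comment> \<open>The series at x recentred at z has radius R/2, and the ball of radius R/4
      about x stays within distance R/2 of z; so vanishing near z reaches a full neighbourhood of
      x.\<close>
    with x(2) obtain z where z: "z \<in> Z" "dist z x < R/4"
      unfolding closure_approachable by (metis divide_pos_pos zero_less_numeral)
    have comp: "\<bar>v $ i\<bar> \<le> norm v" for v :: "real^'n" and i by (rule component_le_norm_cart)
    have y: "\<bar>(z - x) $ i\<bar> \<le> R/2" for i
      using comp[of "z - x" i] z(2) R by (simp add: dist_norm)
    have pz: "\<exists>c. has_powser f z c (R/2)"
      using has_powser_recenter(1)[OF cR y] by auto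
    have ez: "\<forall>\<^sub>F x in nhds z. f x = 0"
      using z(1) unfolding Z_def by (metis (mono_tags, lifting) eventually_nhds interior_subset mem_Collect_eq open_interior subset_iff)
    have "f v = 0" if "v \<in> ball x (R/4)" for v
    proof -
      have "norm (v - z) \<le> R/2"
        using that z(2) dist_triangle[of v z x] by (simp add: dist_norm[symmetric] dist_commute)
      then have "\<bar>(v - z) $ i\<bar> \<le> R/2" for i using comp[of "v - z" i] by linarith
      with pz ez have "f (z + (v - z)) = 0" using has_powser_vanishing by blast
      then show ?thesis by simp
    qed
    then have "ball x (R/4) \<subseteq> Z" unfolding Z_def by (intro interior_maximal) auto
    with R show ?thesis by auto
  qed
  have "\<Omega> \<inter> - closure Z = {}"
  proof (rule ccontr)
    assume ne: "\<Omega> \<inter> - closure Z \<noteq> {}"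
    have "open Z" "open (- closure Z)" "Z \<inter> - closure Z \<inter> \<Omega> = {}" "\<Omega> \<subseteq> Z \<union> - closure Z"
      using closure_subset[of Z] cl by (auto simp: Z_def)
    with connectedD[OF assms(2)] wZ ne show False by blast
  qed
  with cl assms(4) have "x1 \<in> Z" by auto
  then show False using assms(5) interior_subset unfolding Z_def by blast
qed

subsection \<open>Power series solutions of linear equations\<close>

text \<open>The Neumann series of M in a weighted l^1 norm, for which the column sum condition
  bounds the operator norm. As M never lets a higher degree act on a lower one and each degree is
  finite, every application of M is a finite sum; the norm enters only through truncations, with
  bounds uniform in m.\<close>

lemma weighted_contraction_fixed_point:
  fixes deg :: "'i \<Rightarrow> nat" and M :: "'i \<Rightarrow> 'i \<Rightarrow> real" and W h :: "'i \<Rightarrow> real"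
  assumes fin: "\<And>m. finite {i. deg i \<le> m}" and W: "\<And>i. 0 < W i" and \<theta>: "0 \<le> \<theta>" "\<theta> < 1"
    and deg: "\<And>i j. deg i < deg j \<Longrightarrow> M i j = 0"
    and col: "\<And>m j. (\<Sum>i | deg i \<le> m. \<bar>M i j\<bar> * W i) \<le> \<theta> * W j"
    and h: "\<And>m. (\<Sum>i | deg i \<le> m. \<bar>h i\<bar> * W i) \<le> H"
  obtains g where "\<And>m i. deg i \<le> m \<Longrightarrow> g i = h i + (\<Sum>j | deg j \<le> m. M i j * g j)"
    and "\<And>m. (\<Sum>i | deg i \<le> m. \<bar>g i\<bar> * W i) \<le> H / (1 - \<theta>)"
proof -
  define N where "N m g = (\<Sum>i | deg i \<le> m. \<bar>g i\<bar> * W i)" for m and g :: "'i \<Rightarrow> real"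
  define T where "T g i = (\<Sum>j | deg j \<le> deg i. M i j * g j)" for g :: "'i \<Rightarrow> real" and i
  have T: "T g i = (\<Sum>j | deg j \<le> m. M i j * g j)" if "deg i \<le> m" for g m i
    unfolding T_def using fin deg that by (intro sum.mono_neutral_left) auto
  have NT: "N m (T g) \<le> \<theta> * N m g" for m g
  proof -
    have "N m (T g) \<le> (\<Sum>i | deg i \<le> m. \<Sum>j | deg j \<le> m. \<bar>M i j\<bar> * \<bar>g j\<bar> * W i)"
      unfolding N_def
    proof (rule sum_mono)
      fix i assume i: "i \<in> {i. deg i \<le> m}"
      have "\<bar>T g i\<bar> \<le> (\<Sum>j | deg j \<le> m. \<bar>M i j\<bar> * \<bar>g j\<bar>)"
        using T[of i m g] i by (auto simp: abs_mult[symmetric])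
      then show "\<bar>T g i\<bar> * W i \<le> (\<Sum>j | deg j \<le> m. \<bar>M i j\<bar> * \<bar>g j\<bar> * W i)"
        using W[of i] by (simp flip: sum_distrib_right)
    qed
    also have "\<dots> = (\<Sum>j | deg j \<le> m. \<bar>g j\<bar> * (\<Sum>i | deg i \<le> m. \<bar>M i j\<bar> * W i))"
      by (subst sum.swap) (simp add: sum_distrib_left mult_ac)
    also have "\<dots> \<le> (\<Sum>j | deg j \<le> m. \<bar>g j\<bar> * (\<theta> * W j))"
      by (intro sum_mono mult_left_mono col) auto
    finally show ?thesis by (simp add: N_def sum_distrib_left mult_ac)
  qed
  have Nk: "N m ((T ^^ k) h) \<le> \<theta> ^ k * H" for m k
  proof (induction k)
    case (Suc k)
    have "N m ((T ^^ Suc k) h) \<le> \<theta> * N m ((T ^^ k) h)" using NT by simp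
    also have "\<dots> \<le> \<theta> * (\<theta> ^ k * H)" using Suc \<theta> by (intro mult_left_mono) auto
    finally show ?case by (simp add: mult_ac)
  qed (use h in \<open>simp add: N_def\<close>)
  have sm: "summable (\<lambda>k. (T ^^ k) h i)" for i
  proof (rule summable_comparison_test')
    show "summable (\<lambda>k. \<theta> ^ k * (H / W i))"
      using \<theta> by (intro summable_mult2 summable_geometric) auto
    fix k
    have "\<bar>(T ^^ k) h i\<bar> * W i \<le> N (deg i) ((T ^^ k) h)"
      unfolding N_def using W fin by (intro member_le_sum) (auto simp: less_imp_le)
    also have "\<dots> \<le> \<theta> ^ k * H" by (rule Nk)
    finally show "norm ((T ^^ k) h i) \<le> \<theta> ^ k * (H / W i)"
      using W[of i] by (simp add: field_simps)
  qed
  define g where "g i = suminf (\<lambda>k. (T ^^ k) h i)" for i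
  have g: "g i = h i + T g i" for i
  proof -
    have "T g i = (\<Sum>j | deg j \<le> deg i. suminf (\<lambda>k. M i j * (T ^^ k) h j))"
      by (simp add: T_def[of g] g_def suminf_mult[OF sm])
    also have "\<dots> = suminf (\<lambda>k. \<Sum>j | deg j \<le> deg i. M i j * (T ^^ k) h j)"
      by (rule suminf_sum[symmetric]) (intro summable_mult sm)
    also have "\<dots> = suminf (\<lambda>k. (T ^^ Suc k) h i)" by (simp add: T_def)
    also have "\<dots> = g i - h i" unfolding g_def using suminf_split_head[OF sm[of i]] by simp
    finally show ?thesis by simp
  qed
  \<comment> \<open>The truncated norm is a finite number, so N m g \<le> H + \<theta> * N m g can
    be solved for it.\<close>
  have bound: "N m g \<le> H / (1 - \<theta>)" for m
  proof -
    have "N m g \<le> (\<Sum>i | deg i \<le> m. \<bar>h i\<bar> * W i + \<bar>T g i\<bar> * W i)"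
      unfolding N_def
    proof (rule sum_mono)
      fix i
      have "\<bar>g i\<bar> \<le> \<bar>h i\<bar> + \<bar>T g i\<bar>" by (subst g) simp
      then show "\<bar>g i\<bar> * W i \<le> \<bar>h i\<bar> * W i + \<bar>T g i\<bar> * W i"
        using W[of i] by (simp flip: distrib_right)
    qed
    also have "\<dots> = (\<Sum>i | deg i \<le> m. \<bar>h i\<bar> * W i) + N m (T g)"
      by (simp add: N_def sum.distrib)
    also have "\<dots> \<le> H + \<theta> * N m g" using h NT by (intro add_mono) auto
    finally show ?thesis using \<theta> by (simp add: field_simps)
  qed
  show thesis
    by (rule that[of g]) (use g T bound in \<open>auto simp: N_def\<close>)
qed

section \<open>Multinomial weights\<close>

text \<open>The multinomial coefficient (size \<gamma>)! / \<gamma>!, introduced as a number of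
  lists so that both estimates of it are counting arguments.\<close>

definition arrangements :: "'n multiset \<Rightarrow> real" where
  "arrangements \<gamma> = real (card (permutations_of_multiset \<gamma>))"

lemma arrangements_pos [simp]: "0 < arrangements \<gamma>"
  by (simp add: arrangements_def card_gt_0_iff)

lemma arrangements_ge_1: "1 \<le> arrangements \<gamma>"
  by (simp add: arrangements_def Suc_le_eq card_gt_0_iff)

text \<open>Concatenation of arrangements is injective here because the length of the first part is
  known.\<close>

lemma arrangements_union: "arrangements \<gamma> * arrangements \<delta> \<le> arrangements (\<gamma> + \<delta>)"
proof -
  let ?P = permutations_of_multiset
  have "card (?P \<gamma> \<times> ?P \<delta>) \<le> card (?P (\<gamma> + \<delta>))"
  proof (rule card_inj_on_le[where f = "\<lambda>(xs, ys). xs @ ys"])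
    show "inj_on (\<lambda>(xs, ys). xs @ ys) (?P \<gamma> \<times> ?P \<delta>)"
      by (auto simp: inj_on_def dest!: length_finite_permutations_of_multiset)
  qed (auto dest!: permutations_of_multisetD intro!: permutations_of_multisetI)
  then show ?thesis
    by (simp add: arrangements_def card_cartesian_product flip: of_nat_mult)
qed

lemma arrangements_le: "arrangements \<gamma> \<le> CARD('n) ^ size \<gamma>" for \<gamma> :: "'n::finite multiset"
proof -
  have "card (permutations_of_multiset \<gamma>) \<le> card {xs :: 'n list. set xs \<subseteq> UNIV \<and> length xs = size \<gamma>}"
    by (intro card_mono finite_lists_length_eq) (auto simp: length_finite_permutations_of_multiset)
  also have "\<dots> = CARD('n) ^ size \<gamma>" by (rule card_lists_length_eq) simp
  finally show ?thesis
    unfolding arrangements_def by (simp only: of_nat_le_iff flip: of_nat_power)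
qed

lemma arrangements_mfact: "arrangements \<gamma> * mfact \<gamma> = fact (size \<gamma>)" for \<gamma> :: "'n::finite multiset"
proof -
  have "mfact \<gamma> = (\<Prod>x\<in>set_mset \<gamma>. fact (count \<gamma> x))"
    unfolding mfact_def by (intro prod.mono_neutral_right) (auto simp: not_in_iff)
  then have "arrangements \<gamma> * mfact \<gamma> = real (card (permutations_of_multiset \<gamma>) * (\<Prod>x\<in>set_mset \<gamma>. fact (count \<gamma> x)))"
    by (simp add: arrangements_def)
  then show ?thesis unfolding card_permutations_of_multiset_aux by simp
qed

lemma mfact_mono: "mfact \<gamma> \<le> mfact (\<beta> + \<gamma>)"
  unfolding mfact_def by (intro prod_mono) (auto intro: fact_mono)

(* Division by the multinomial coefficient makes the \<alpha>-th derivative of a \<beta>-fold antiderivative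
   bounded whenever size \<alpha> \<le> size \<beta> (without it, the derivative in x2 of an antiderivative in x1
   is unbounded), and keeps the weights submultiplicative. *)
definition weight :: "('n \<Rightarrow> real) \<Rightarrow> 'n multiset \<Rightarrow> real" where
  "weight r \<gamma> = mpow r \<gamma> / arrangements \<gamma>"

lemma weight_pos: "(\<And>i. 0 < r i) \<Longrightarrow> 0 < weight r \<gamma>"
  by (simp add: weight_def mpow_pos)

lemma weight_le_mpow: "(\<And>i. 0 < r i) \<Longrightarrow> weight r \<gamma> \<le> mpow r \<gamma>"
  using arrangements_ge_1[of \<gamma>] mpow_pos[of r \<gamma>] by (simp add: weight_def divide_le_eq)

lemma weight_union:
  assumes "\<And>i. 0 < r i"
  shows "weight r (\<gamma> + \<delta>) \<le> weight r \<gamma> * weight r \<delta>"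
  unfolding weight_def mpow_union times_divide_times_eq
  using arrangements_union[of \<gamma> \<delta>] mpow_pos[of r, OF assms] by (intro divide_left_mono) (auto simp: less_imp_le)

text \<open>The \<alpha>-th derivative of the \<beta>-fold antiderivative moves the monomial
  \<gamma> to \<epsilon> with factor \<gamma>! / \<epsilon>!. The \<epsilon>! in the weight of
  \<epsilon> cancels the denominator, and size \<gamma> \<le> size \<epsilon> compares the remaining
  factorials.\<close>

lemma weight_shift:
  fixes \<alpha> \<beta> \<gamma> \<epsilon> :: "'n::finite multiset"
  assumes r: "\<And>i. 0 < r i" and eq: "\<alpha> + \<epsilon> = \<gamma> + \<beta>" and le: "size \<alpha> \<le> size \<beta>"
  shows "mfact \<gamma> / mfact \<epsilon> * weight r \<epsilon> \<le> mpow r \<beta> / mpow r \<alpha> * weight r \<gamma>"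
proof -
  have pos: "0 < mpow r \<zeta>" for \<zeta> using r by (rule mpow_pos)
  have w: "weight r \<zeta> = mpow r \<zeta> * mfact \<zeta> / fact (size \<zeta>)" for \<zeta> :: "'n multiset"
    unfolding weight_def arrangements_mfact[symmetric] by simp
  have "mpow r \<alpha> * mpow r \<epsilon> = mpow r \<gamma> * mpow r \<beta>" by (simp add: eq flip: mpow_union)
  then have e: "mpow r \<epsilon> = mpow r \<beta> / mpow r \<alpha> * mpow r \<gamma>"
    using pos[of \<alpha>] by (simp add: field_simps)
  have "size \<alpha> + size \<epsilon> = size \<gamma> + size \<beta>" using eq by (metis size_union)
  then have "(fact (size \<gamma>) :: real) \<le> fact (size \<epsilon>)" using le by (intro fact_mono) auto
  then have "mpow r \<epsilon> * mfact \<gamma> / fact (size \<epsilon>) \<le> mpow r \<epsilon> * mfact \<gamma> / fact (size \<gamma>)"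
    using pos[of \<epsilon>] by (intro divide_left_mono mult_nonneg_nonneg) (auto simp: less_imp_le)
  then show ?thesis unfolding w by (simp add: e mult_ac)
qed

section \<open>Choice of the leading derivative\<close>

lemma exists_vertex:
  fixes A :: "'n::finite multiset set"
  assumes "finite A" "A \<noteq> {}"
  obtains \<beta> where "\<beta> \<in> A"
    and "\<And>\<alpha>. \<alpha> \<in> A \<Longrightarrow> \<alpha> \<noteq> \<beta> \<Longrightarrow> (\<Sum>i\<in>UNIV. count \<beta> i * count \<alpha> i) < (\<Sum>i\<in>UNIV. count \<beta> i * count \<beta> i)"
proof -
  let ?q = "\<lambda>\<alpha> :: 'n multiset. \<Sum>i\<in>UNIV. count \<alpha> i * count \<alpha> i"
  (* An element of maximal Euclidean norm is a vertex, exposed by the functional it defines itself. *)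
  obtain \<beta> where \<beta>: "\<beta> \<in> A" "\<And>\<alpha>. \<alpha> \<in> A \<Longrightarrow> ?q \<alpha> \<le> ?q \<beta>"
  proof -
    have "Max (?q ` A) \<in> ?q ` A" using assms by (intro Max_in) auto
    then obtain \<beta> where \<beta>: "\<beta> \<in> A" "?q \<beta> = Max (?q ` A)" by (metis (no_types, lifting) imageE)
    show thesis
      by (rule that[OF \<beta>(1)]) (use assms(1) in \<open>simp add: \<beta>(2)\<close>)
  qed
  have "(\<Sum>i\<in>UNIV. count \<beta> i * count \<alpha> i) < ?q \<beta>" if \<alpha>: "\<alpha> \<in> A" "\<alpha> \<noteq> \<beta>" for \<alpha>
  proof -
    obtain j where j: "count \<alpha> j \<noteq> count \<beta> j" using \<alpha>(2) by (metis multiset_eqI)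
    \<comment> \<open>Expanding the square of \<beta> - \<alpha> and using the maximality of \<beta>
      gives twice the strict inequality; integers are used because natural subtraction
      truncates.\<close>
    have "0 < (\<Sum>i\<in>UNIV. (int (count \<beta> i) - int (count \<alpha> i))\<^sup>2)"
      by (rule sum_pos2[of _ j]) (use j in auto)
    also have "\<dots> = (\<Sum>i\<in>UNIV. int (count \<beta> i * count \<beta> i) + int (count \<alpha> i * count \<alpha> i) - 2 * int (count \<beta> i * count \<alpha> i))"
      by (simp add: power2_diff) (simp add: power2_eq_square algebra_simps)
    also have "\<dots> = int (?q \<beta>) + int (?q \<alpha>) - 2 * int (\<Sum>i\<in>UNIV. count \<beta> i * count \<alpha> i)"
      by (simp only: sum.distrib sum_subtractf sum_distrib_left[symmetric] of_nat_sum)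
    finally show ?thesis using \<beta>(2)[OF \<alpha>(1)] by linarith
  qed
  with \<beta>(1) that show thesis by blast
qed

lemma mpow_power: "mpow (\<lambda>i. \<rho> * t ^ p i) \<alpha> = \<rho> ^ size \<alpha> * t ^ (\<Sum>i\<in>UNIV. p i * count \<alpha> i)"
  for \<alpha> :: "'n::finite multiset"
proof -
  have "size \<alpha> = (\<Sum>i\<in>UNIV. count \<alpha> i)"
    unfolding size_multiset_overloaded_eq by (intro sum.mono_neutral_left) (auto simp: not_in_iff)
  then show ?thesis
    by (simp add: mpow_eq_prod power_mult_distrib prod.distrib power_sum power_mult)
qed

lemma sum_le_infsum_real:
  fixes f g :: "'a \<Rightarrow> real"
  assumes "g summable_on UNIV" "finite F" "\<And>x. x \<in> F \<Longrightarrow> f x \<le> g x" "\<And>x. 0 \<le> g x"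
  shows "sum f F \<le> infsum g UNIV"
  using sum_mono[of F f g] finite_sum_le_infsum[OF assms(1,2)] assms(3,4) by fastforce

section \<open>The Goursat problem for power series coefficients\<close>

text \<open>\<open>b \<alpha> \<delta>\<close> is the \<delta>-th power series coefficient of the
  function multiplying the \<alpha>-th derivative, so the last conjunct is the equation read off by
  coefficients of Cauchy products. The unknown g is the \<beta>-th derivative of the solution:
  dividing by the constant \<open>B\<close> isolates it.\<close>

lemma power_series_solution:
  fixes b :: "'n::finite multiset \<Rightarrow> 'n multiset \<Rightarrow> real"
  assumes s: "s \<ge> 1" and R: "R > 0"
    and sb: "\<And>\<alpha>. size \<alpha> \<le> s \<Longrightarrow> (\<lambda>\<delta>. \<bar>b \<alpha> \<delta>\<bar> * R ^ size \<delta>) summable_on UNIV"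
    and ex: "\<exists>\<alpha>. size \<alpha> = s \<and> b \<alpha> {#} \<noteq> 0"
  shows "\<exists>c R'. R' > 0 \<and> (\<lambda>\<gamma>. \<bar>c \<gamma>\<bar> * R' ^ size \<gamma>) summable_on UNIV \<and> c {#} = 1 \<and>
    (\<forall>\<gamma>. (\<Sum>\<alpha> | size \<alpha> \<le> s. \<Sum>\<delta> | \<delta> \<subseteq># \<gamma>. b \<alpha> \<delta> * cderiv \<alpha> c (\<gamma> - \<delta>)) = 0)"
proof -
  define A where "A = {\<alpha> :: 'n multiset. size \<alpha> = s \<and> b \<alpha> {#} \<noteq> 0}"
  have "finite A" "A \<noteq> {}"
    using ex by (auto simp: A_def intro: finite_subset[OF _ finite_size_le[of s]])
  then obtain \<beta> where \<beta>A: "\<beta> \<in> A"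
    and vertex: "\<And>\<alpha>. \<alpha> \<in> A \<Longrightarrow> \<alpha> \<noteq> \<beta> \<Longrightarrow> (\<Sum>i\<in>UNIV. count \<beta> i * count \<alpha> i) < (\<Sum>i\<in>UNIV. count \<beta> i * count \<beta> i)"
    using exists_vertex by blast
  define ip where "ip \<alpha> = (\<Sum>i\<in>UNIV. count \<beta> i * count \<alpha> i)" for \<alpha> :: "'n multiset"
  define B where "B = b \<beta> {#}"
  have B: "B \<noteq> 0" and size\<beta>: "size \<beta> = s" using \<beta>A by (auto simp: A_def B_def)
  \<comment> \<open>What stays on the other side once the constant \<open>B\<close> in front of the
    \<beta>-th derivative is split off.\<close>
  define b' where "b' \<alpha> \<delta> = (if \<alpha> = \<beta> \<and> \<delta> = {#} then 0 else b \<alpha> \<delta>)" for \<alpha> \<delta>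
  define I where "I = {\<alpha> :: 'n multiset. size \<alpha> \<le> s}"
  have finI [simp]: "finite I" by (simp add: I_def)
  \<comment> \<open>A common bound of all coefficient series at radius R; the summand 1 makes it
    positive, as it appears in denominators below.\<close>
  define K where "K = (\<Sum>\<alpha>\<in>I. \<Sum>\<^sub>\<infinity>\<delta>. \<bar>b \<alpha> \<delta>\<bar> * R ^ size \<delta>) + 1"
  have K_ge: "(\<Sum>\<^sub>\<infinity>\<delta>. \<bar>b \<alpha> \<delta>\<bar> * R ^ size \<delta>) \<le> K" if "\<alpha> \<in> I" for \<alpha>
  proof -
    have "(\<Sum>\<^sub>\<infinity>\<delta>. \<bar>b \<alpha> \<delta>\<bar> * R ^ size \<delta>) \<le> (\<Sum>\<alpha>\<in>I. \<Sum>\<^sub>\<infinity>\<delta>. \<bar>b \<alpha> \<delta>\<bar> * R ^ size \<delta>)"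
      using that R by (intro member_le_sum infsum_nonneg) auto
    then show ?thesis by (simp add: K_def)
  qed
  have K: "K \<ge> 1"
    unfolding K_def using R by (auto intro!: sum_nonneg infsum_nonneg)
  \<comment> \<open>\<open>ip \<alpha>\<close> is the exponent of t in r^\<alpha>; as t \<le> 1, a
    bound P for all of them bounds 1 / t^(ip \<alpha>) by 1 / t^P.\<close>
  define P where "P = (\<Sum>\<alpha>\<in>I. ip \<alpha>)"
  have P: "ip \<alpha> \<le> P" if "\<alpha> \<in> I" for \<alpha>
    unfolding P_def using that by (intro member_le_sum) auto
  define L where "L = real (card I)"
  have L: "L > 0" unfolding L_def using size\<beta> by (auto simp: card_gt_0_iff I_def intro!: exI[of _ \<beta>])
  \<comment> \<open>Each of the at most L terms of order s with nonzero constant part will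
    contribute at most K t. A total of \<bar>B\<bar> / 4 is half of what the contraction factor 1/2
    allows after division by B.\<close>
  define t where "t = min 1 (\<bar>B\<bar> / (4 * L * K))"
  have t: "0 < t" "t \<le> 1" "L * (K * t) \<le> \<bar>B\<bar> / 4"
    using B L K by (auto simp: t_def min_def field_simps)
  \<comment> \<open>The other quarter of \<bar>B\<bar>: terms of lower order cost at most K \<rho> /
    t^P, those without constant part at most K (\<rho> / R) / t^P, whence the factor 1/R + 1. The
    cap 1 makes powers of \<rho> decrease, and the cap R keeps the weights below
    \<open>R ^ size \<gamma>\<close>.\<close>
  define \<rho> where "\<rho> = min (min 1 R) (\<bar>B\<bar> * t ^ P / (4 * L * K * (1 / R + 1)))"
  have \<rho>: "0 < \<rho>" "\<rho> \<le> 1" "\<rho> \<le> R"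
    using B L K R t(1) by (auto simp: \<rho>_def intro!: divide_pos_pos mult_pos_pos add_pos_pos)
  have \<rho>4: "L * (K * (\<rho> * (1 / R + 1) / t ^ P)) \<le> \<bar>B\<bar> / 4"
  proof -
    have q: "0 < 4 * L * K * (1 / R + 1)" using L K R by (intro mult_pos_pos add_pos_pos) auto
    have "\<rho> \<le> \<bar>B\<bar> * t ^ P / (4 * L * K * (1 / R + 1))" by (simp add: \<rho>_def)
    then have "\<rho> * (4 * L * K * (1 / R + 1)) \<le> \<bar>B\<bar> * t ^ P" using q by (simp add: pos_le_divide_eq)
    then have "\<rho> * (4 * L * K * (1 / R + 1)) / t ^ P \<le> \<bar>B\<bar>" using t(1) by (simp add: pos_divide_le_eq)
    then show ?thesis by (simp add: mult_ac)
  qed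
  define r where "r i = \<rho> * t ^ count \<beta> i" for i
  have r: "0 < r i" "r i \<le> \<rho>" for i
    using \<rho>(1) t by (auto simp: r_def mult_le_cancel_left1 power_le_one)
  have mpr: "mpow r \<alpha> = \<rho> ^ size \<alpha> * t ^ ip \<alpha>" for \<alpha>
    unfolding r_def ip_def by (rule mpow_power)
  let ?W = "weight r"
  have W: "0 < ?W \<gamma>" for \<gamma> using r(1) by (rule weight_pos)
  have W\<rho>: "?W \<gamma> \<le> \<rho> ^ size \<gamma>" for \<gamma>
  proof -
    have "?W \<gamma> \<le> mpow r \<gamma>" using r(1) by (rule weight_le_mpow)
    also have "\<dots> \<le> mpow (\<lambda>_. \<rho>) \<gamma>" by (rule mpow_mono) (auto simp: r less_imp_le)
    finally show ?thesis by simp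
  qed
  have N1: "(\<Sum>\<delta> | size \<delta> \<le> m. \<bar>b' \<alpha> \<delta>\<bar> * ?W \<delta>) \<le> K" if "\<alpha> \<in> I" for \<alpha> m
  proof -
    have "\<bar>b' \<alpha> \<delta>\<bar> * ?W \<delta> \<le> \<bar>b \<alpha> \<delta>\<bar> * R ^ size \<delta>" for \<delta>
    proof (rule mult_mono)
      have "\<rho> ^ size \<delta> \<le> R ^ size \<delta>" using \<rho> by (intro power_mono) auto
      then show "?W \<delta> \<le> R ^ size \<delta>" using W\<rho>[of \<delta>] by linarith
    qed (auto simp: b'_def less_imp_le[OF W])
    then have "(\<Sum>\<delta> | size \<delta> \<le> m. \<bar>b' \<alpha> \<delta>\<bar> * ?W \<delta>) \<le> (\<Sum>\<^sub>\<infinity>\<delta>. \<bar>b \<alpha> \<delta>\<bar> * R ^ size \<delta>)"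
      using that R by (intro sum_le_infsum_real sb) (auto simp: I_def)
    with K_ge[OF that] show ?thesis by linarith
  qed
  \<comment> \<open>Without a constant term only degrees k \<ge> 1 remain, and there \<rho>^k \<le>
    (\<rho> / R) R^k.\<close>
  have N2: "(\<Sum>\<delta> | size \<delta> \<le> m. \<bar>b' \<alpha> \<delta>\<bar> * ?W \<delta>) \<le> \<rho> / R * K" if "\<alpha> \<in> I" "b' \<alpha> {#} = 0" for \<alpha> m
  proof -
    have le: "\<bar>b' \<alpha> \<delta>\<bar> * ?W \<delta> \<le> \<rho> / R * (\<bar>b \<alpha> \<delta>\<bar> * R ^ size \<delta>)" for \<delta>
    proof (cases "\<delta> = {#}")
      case False
      then obtain k where k: "size \<delta> = Suc k" by (metis not0_implies_Suc size_eq_0_iff_empty)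
      have "\<rho> ^ size \<delta> \<le> \<rho> / R * R ^ size \<delta>"
        using \<rho> R by (auto simp: k intro!: power_mono)
      then have "?W \<delta> \<le> \<rho> / R * R ^ size \<delta>" using W\<rho>[of \<delta>] by linarith
      then have "\<bar>b' \<alpha> \<delta>\<bar> * ?W \<delta> \<le> \<bar>b \<alpha> \<delta>\<bar> * (\<rho> / R * R ^ size \<delta>)"
        by (intro mult_mono) (auto simp: b'_def less_imp_le[OF W])
      then show ?thesis by (simp add: mult_ac)
    qed (use that \<rho> R in auto)
    have "(\<Sum>\<delta> | size \<delta> \<le> m. \<bar>b' \<alpha> \<delta>\<bar> * ?W \<delta>) \<le> (\<Sum>\<^sub>\<infinity>\<delta>. \<rho> / R * (\<bar>b \<alpha> \<delta>\<bar> * R ^ size \<delta>))"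
      using that R \<rho> by (intro sum_le_infsum_real summable_on_cmult_right sb le) (auto simp: I_def)
    also have "\<dots> = \<rho> / R * (\<Sum>\<^sub>\<infinity>\<delta>. \<bar>b \<alpha> \<delta>\<bar> * R ^ size \<delta>)" by (rule infsum_cmult_right')
    also have "\<dots> \<le> \<rho> / R * K" using K_ge[OF that(1)] \<rho> R by (intro mult_left_mono) auto
    finally show ?thesis .
  qed
  define q where "q \<alpha> = mpow r \<beta> / mpow r \<alpha>" for \<alpha>
  have q0: "0 \<le> q \<alpha>" for \<alpha> using mpow_pos[of r, OF r(1)] by (simp add: q_def less_imp_le)
  define \<tau> where "\<tau> = K * t + K * (\<rho> * (1 / R + 1) / t ^ P)"
  have tP: "0 < t ^ P" using t by simp
  have qP: "q \<alpha> \<le> \<rho> ^ (s - size \<alpha>) / t ^ P" if "\<alpha> \<in> I" for \<alpha>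
  proof -
    have "\<rho> ^ s = \<rho> ^ (s - size \<alpha>) * \<rho> ^ size \<alpha>" using that by (simp add: I_def flip: power_add)
    then have "q \<alpha> = \<rho> ^ (s - size \<alpha>) * t ^ ip \<beta> / t ^ ip \<alpha>"
      using \<rho>(1) by (simp add: q_def mpr size\<beta>)
    also have "\<dots> \<le> \<rho> ^ (s - size \<alpha>) * 1 / t ^ P"
      using \<rho> t P[OF that] by (intro frac_le mult_left_mono power_le_one power_decreasing) auto
    finally show ?thesis by simp
  qed
  have bnd: "(\<Sum>\<delta> | size \<delta> \<le> m. \<bar>b' \<alpha> \<delta>\<bar> * ?W \<delta>) * q \<alpha> \<le> \<tau>" if \<alpha>: "\<alpha> \<in> I" for \<alpha> m
  proof -
    let ?N = "\<Sum>\<delta> | size \<delta> \<le> m. \<bar>b' \<alpha> \<delta>\<bar> * ?W \<delta>"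
    have Kt: "0 \<le> K * t" and Kr: "0 \<le> K * \<rho> / t ^ P" "0 \<le> K * \<rho> / R / t ^ P" using K t \<rho> R by auto
    have \<tau>_eq: "\<tau> = K * t + K * \<rho> / t ^ P + K * \<rho> / R / t ^ P" by (simp add: \<tau>_def algebra_simps add_divide_distrib)
    \<comment> \<open>The three sources of smallness: the order drops (factor \<rho>), the
      coefficient vanishes at the centre (factor \<rho> / R), or \<alpha> competes with \<beta> and
      the vertex property gives a factor t. The index \<beta> itself falls under the second case, as
      its constant part was removed.\<close>
    consider "size \<alpha> < s" | "size \<alpha> = s" "b' \<alpha> {#} = 0" | "size \<alpha> = s" "b' \<alpha> {#} \<noteq> 0"
      using \<alpha> by (fastforce simp: I_def)
    then show ?thesis
    proof cases
      case 1
      have "\<rho> ^ (s - size \<alpha>) \<le> \<rho> ^ 1" using \<rho> 1 by (intro power_decreasing) auto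
      then have "\<rho> ^ (s - size \<alpha>) / t ^ P \<le> \<rho> / t ^ P" using tP by (intro divide_right_mono) auto
      with qP[OF \<alpha>] have "q \<alpha> \<le> \<rho> / t ^ P" by linarith
      then have "?N * q \<alpha> \<le> K * (\<rho> / t ^ P)" using N1[OF \<alpha>] q0 K by (intro mult_mono) auto
      then show ?thesis using Kt Kr by (simp add: \<tau>_eq)
    next
      case 2
      with qP[OF \<alpha>] have "q \<alpha> \<le> 1 / t ^ P" by simp
      then have "?N * q \<alpha> \<le> (\<rho> / R * K) * (1 / t ^ P)"
        using N2[OF \<alpha>] 2 q0 K \<rho> R by (intro mult_mono) auto
      then show ?thesis using Kt Kr by (simp add: \<tau>_eq mult_ac)
    next
      case 3
      then have "\<alpha> \<in> A" "\<alpha> \<noteq> \<beta>" by (auto simp: b'_def A_def split: if_splits)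
      then have "ip \<alpha> < ip \<beta>" using vertex by (simp add: ip_def)
      then have "ip \<beta> = ip \<alpha> + 1 + (ip \<beta> - ip \<alpha> - 1)" by simp
      then have "t ^ ip \<beta> = t ^ ip \<alpha> * t * t ^ (ip \<beta> - ip \<alpha> - 1)" by (metis power_add power_one_right)
      then have "q \<alpha> = t * t ^ (ip \<beta> - ip \<alpha> - 1)"
        using \<rho>(1) t(1) by (simp add: q_def mpr size\<beta> 3)
      also have "\<dots> \<le> t * 1" using t by (intro mult_left_mono power_le_one) auto
      finally have "?N * q \<alpha> \<le> K * t" using N1[OF \<alpha>] q0 K by (intro mult_mono) auto
      then show ?thesis using Kr by (simp add: \<tau>_eq)
    qed
  qed
  have \<tau>: "L * \<tau> \<le> \<bar>B\<bar> / 2" using t(3) \<rho>4 unfolding \<tau>_def distrib_left[of L] by linarith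
  \<comment> \<open>The matrix entry from \<gamma> to \<epsilon> of the \<alpha>-th derivative after
    the \<beta>-fold antiderivative; \<open>M\<close> combines it with multiplication by the series
    \<open>b'\<close>, moved to the right-hand side and divided by B.\<close>
  define Kf where "Kf \<alpha> \<epsilon> \<gamma> = (if \<alpha> + \<epsilon> = \<gamma> + \<beta> then mfact \<gamma> / mfact \<epsilon> else 0)" for \<alpha> \<epsilon> \<gamma>
  define M where "M \<gamma> \<gamma>' = - (1 / B) * (\<Sum>\<alpha>\<in>I. \<Sum>\<delta> | \<delta> \<subseteq># \<gamma>. b' \<alpha> \<delta> * Kf \<alpha> (\<gamma> - \<delta>) \<gamma>')" for \<gamma> \<gamma>'
  have Kf_size: "size \<gamma>' \<le> size \<epsilon>" if "Kf \<alpha> \<epsilon> \<gamma>' \<noteq> 0" "\<alpha> \<in> I" for \<alpha> \<epsilon> \<gamma>'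
  proof -
    have "\<alpha> + \<epsilon> = \<gamma>' + \<beta>" using that by (auto simp: Kf_def split: if_splits)
    then have "size \<alpha> + size \<epsilon> = size \<gamma>' + s" by (metis size_union size\<beta>)
    then show ?thesis using that(2) by (simp add: I_def)
  qed
  have colterm: "(\<Sum>\<gamma> | size \<gamma> \<le> m. \<Sum>\<delta> | \<delta> \<subseteq># \<gamma>. \<bar>b' \<alpha> \<delta>\<bar> * Kf \<alpha> (\<gamma> - \<delta>) \<gamma>' * ?W \<gamma>) \<le> \<tau> * ?W \<gamma>'"
    if \<alpha>: "\<alpha> \<in> I" for \<alpha> \<gamma>' m
  proof -
    let ?X = "\<lambda>\<delta>. \<bar>b' \<alpha> \<delta>\<bar> * ?W \<delta> * q \<alpha> * ?W \<gamma>'"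
    have X: "0 \<le> ?X \<delta>" for \<delta> using W q0 by (simp add: less_imp_le)
    \<comment> \<open>\<open>Kf\<close> forces \<gamma> - \<delta> = \<gamma>' + \<beta> - \<alpha>,
      so \<delta> determines \<gamma> and the double sum is really a sum over \<delta>.
      Submultiplicative weights split off the norm of \<open>b' \<alpha>\<close>, and
      \<open>weight_shift\<close> supplies \<open>q \<alpha>\<close>.\<close>
    have "(\<Sum>\<gamma> | size \<gamma> \<le> m. \<Sum>\<delta> | \<delta> \<subseteq># \<gamma>. \<bar>b' \<alpha> \<delta>\<bar> * Kf \<alpha> (\<gamma> - \<delta>) \<gamma>' * ?W \<gamma>)
      \<le> (\<Sum>\<gamma> | size \<gamma> \<le> m. \<Sum>\<delta> | \<delta> \<subseteq># \<gamma>. if \<gamma> = \<delta> + (\<gamma>' + \<beta> - \<alpha>) then ?X \<delta> else 0)"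
    proof (intro sum_mono)
      fix \<gamma> \<delta> :: "'n multiset" assume "\<delta> \<in> {\<delta>. \<delta> \<subseteq># \<gamma>}"
      then have \<gamma>: "\<gamma> = \<delta> + (\<gamma> - \<delta>)" by simp
      show "\<bar>b' \<alpha> \<delta>\<bar> * Kf \<alpha> (\<gamma> - \<delta>) \<gamma>' * ?W \<gamma> \<le> (if \<gamma> = \<delta> + (\<gamma>' + \<beta> - \<alpha>) then ?X \<delta> else 0)"
      proof (cases "\<alpha> + (\<gamma> - \<delta>) = \<gamma>' + \<beta>")
        case True
        then have "\<gamma> - \<delta> = \<gamma>' + \<beta> - \<alpha>" by (metis add_diff_cancel_left')
        with \<gamma> have g: "\<gamma> = \<delta> + (\<gamma>' + \<beta> - \<alpha>)" by simp
        have "Kf \<alpha> (\<gamma> - \<delta>) \<gamma>' * ?W \<gamma> \<le> Kf \<alpha> (\<gamma> - \<delta>) \<gamma>' * (?W \<delta> * ?W (\<gamma> - \<delta>))"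
        proof (rule mult_left_mono)
          show "?W \<gamma> \<le> ?W \<delta> * ?W (\<gamma> - \<delta>)" by (subst (1) \<gamma>) (rule weight_union[OF r(1)])
        qed (simp add: Kf_def less_imp_le)
        also have "\<dots> = ?W \<delta> * (mfact \<gamma>' / mfact (\<gamma> - \<delta>) * ?W (\<gamma> - \<delta>))" using True by (simp add: Kf_def)
        also have "\<dots> \<le> ?W \<delta> * (q \<alpha> * ?W \<gamma>')"
          unfolding q_def using True \<alpha> W by (intro mult_left_mono weight_shift r) (auto simp: I_def size\<beta> less_imp_le)
        finally have "\<bar>b' \<alpha> \<delta>\<bar> * (Kf \<alpha> (\<gamma> - \<delta>) \<gamma>' * ?W \<gamma>) \<le> \<bar>b' \<alpha> \<delta>\<bar> * (?W \<delta> * (q \<alpha> * ?W \<gamma>'))"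
          by (rule mult_left_mono) simp
        then show ?thesis using g by (simp add: mult_ac)
      qed (use X in \<open>simp add: Kf_def\<close>)
    qed
    also have "\<dots> = (\<Sum>\<gamma> | size \<gamma> \<le> m. \<Sum>\<delta> | \<delta> \<subseteq># \<gamma> \<and> \<gamma> = \<delta> + (\<gamma>' + \<beta> - \<alpha>). ?X \<delta>)"
      by (rule sum.cong[OF refl], subst sum.inter_filter[symmetric]) simp_all
    also have "\<dots> = (\<Sum>(\<gamma>, \<delta>) \<in> (SIGMA \<gamma>:{\<gamma>. size \<gamma> \<le> m}. {\<delta>. \<delta> \<subseteq># \<gamma> \<and> \<gamma> = \<delta> + (\<gamma>' + \<beta> - \<alpha>)}). ?X \<delta>)"
      by (rule sum.Sigma) auto
    also have "\<dots> = sum ?X (snd ` (SIGMA \<gamma>:{\<gamma>. size \<gamma> \<le> m}. {\<delta>. \<delta> \<subseteq># \<gamma> \<and> \<gamma> = \<delta> + (\<gamma>' + \<beta> - \<alpha>)}))"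
      by (subst sum.reindex) (auto simp: inj_on_def case_prod_unfold)
    also have "\<dots> \<le> (\<Sum>\<delta> | size \<delta> \<le> m. ?X \<delta>)"
      by (rule sum_mono2) (use X in \<open>auto dest!: size_mset_mono\<close>)
    also have "\<dots> = (\<Sum>\<delta> | size \<delta> \<le> m. \<bar>b' \<alpha> \<delta>\<bar> * ?W \<delta>) * q \<alpha> * ?W \<gamma>'"
      by (simp add: sum_distrib_right)
    also have "\<dots> \<le> \<tau> * ?W \<gamma>'"
      using bnd[OF \<alpha>] W by (intro mult_right_mono) (auto simp: less_imp_le)
    finally show ?thesis .
  qed
  have col: "(\<Sum>\<gamma> | size \<gamma> \<le> m. \<bar>M \<gamma> \<gamma>'\<bar> * ?W \<gamma>) \<le> 1/2 * ?W \<gamma>'" for m \<gamma>'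
  proof -
    have "(\<Sum>\<gamma> | size \<gamma> \<le> m. \<bar>M \<gamma> \<gamma>'\<bar> * ?W \<gamma>)
      \<le> (\<Sum>\<gamma> | size \<gamma> \<le> m. 1 / \<bar>B\<bar> * (\<Sum>\<alpha>\<in>I. \<Sum>\<delta> | \<delta> \<subseteq># \<gamma>. \<bar>b' \<alpha> \<delta>\<bar> * Kf \<alpha> (\<gamma> - \<delta>) \<gamma>' * ?W \<gamma>))"
    proof (rule sum_mono)
      fix \<gamma>
      have "\<bar>\<Sum>\<alpha>\<in>I. \<Sum>\<delta> | \<delta> \<subseteq># \<gamma>. b' \<alpha> \<delta> * Kf \<alpha> (\<gamma> - \<delta>) \<gamma>'\<bar>
        \<le> (\<Sum>\<alpha>\<in>I. \<Sum>\<delta> | \<delta> \<subseteq># \<gamma>. \<bar>b' \<alpha> \<delta> * Kf \<alpha> (\<gamma> - \<delta>) \<gamma>'\<bar>)"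
        by (rule order_trans[OF sum_abs]) (intro sum_mono sum_abs)
      also have "\<dots> = (\<Sum>\<alpha>\<in>I. \<Sum>\<delta> | \<delta> \<subseteq># \<gamma>. \<bar>b' \<alpha> \<delta>\<bar> * Kf \<alpha> (\<gamma> - \<delta>) \<gamma>')"
        by (intro sum.cong refl) (auto simp: abs_mult Kf_def less_imp_le)
      finally have "\<bar>M \<gamma> \<gamma>'\<bar> \<le> 1 / \<bar>B\<bar> * (\<Sum>\<alpha>\<in>I. \<Sum>\<delta> | \<delta> \<subseteq># \<gamma>. \<bar>b' \<alpha> \<delta>\<bar> * Kf \<alpha> (\<gamma> - \<delta>) \<gamma>')"
        unfolding M_def abs_mult by (simp add: divide_right_mono)
      from mult_right_mono[OF this less_imp_le[OF W[of \<gamma>]]]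
      show "\<bar>M \<gamma> \<gamma>'\<bar> * ?W \<gamma> \<le> 1 / \<bar>B\<bar> * (\<Sum>\<alpha>\<in>I. \<Sum>\<delta> | \<delta> \<subseteq># \<gamma>. \<bar>b' \<alpha> \<delta>\<bar> * Kf \<alpha> (\<gamma> - \<delta>) \<gamma>' * ?W \<gamma>)"
        by (simp add: sum_distrib_right)
    qed
    also have "\<dots> = 1 / \<bar>B\<bar> * (\<Sum>\<alpha>\<in>I. \<Sum>\<gamma> | size \<gamma> \<le> m. \<Sum>\<delta> | \<delta> \<subseteq># \<gamma>. \<bar>b' \<alpha> \<delta>\<bar> * Kf \<alpha> (\<gamma> - \<delta>) \<gamma>' * ?W \<gamma>)"
      unfolding sum_distrib_left[symmetric] by (subst sum.swap) (rule refl)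
    also have "\<dots> \<le> 1 / \<bar>B\<bar> * (\<Sum>\<alpha>\<in>I. \<tau> * ?W \<gamma>')"
      by (intro mult_left_mono sum_mono colterm) auto
    also have "\<dots> = (L * \<tau>) / \<bar>B\<bar> * ?W \<gamma>'" by (simp add: L_def)
    also have "\<dots> \<le> 1/2 * ?W \<gamma>'"
      using \<tau> B W by (intro mult_right_mono) (auto simp: less_imp_le field_simps)
    finally show ?thesis .
  qed
  \<comment> \<open>Only the term of order zero sees the summand 1 of the solution; its series
    becomes the inhomogeneity.\<close>
  define h where "h \<gamma> = - (1 / B) * b' {#} \<gamma>" for \<gamma>
  obtain g where g: "\<And>m \<gamma>. size \<gamma> \<le> m \<Longrightarrow> g \<gamma> = h \<gamma> + (\<Sum>\<gamma>' | size \<gamma>' \<le> m. M \<gamma> \<gamma>' * g \<gamma>')"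
    and gb: "\<And>m. (\<Sum>\<gamma> | size \<gamma> \<le> m. \<bar>g \<gamma>\<bar> * ?W \<gamma>) \<le> (K / \<bar>B\<bar>) / (1 - 1/2)"
  proof (rule weighted_contraction_fixed_point[of size ?W "1/2" M h "K / \<bar>B\<bar>"])
    show "M \<gamma> \<gamma>' = 0" if "size \<gamma> < size \<gamma>'" for \<gamma> \<gamma>'
    proof -
      have "Kf \<alpha> (\<gamma> - \<delta>) \<gamma>' = 0" if \<alpha>: "\<alpha> \<in> I" and "\<delta> \<subseteq># \<gamma>" for \<alpha> \<delta>
      proof (rule ccontr)
        assume "Kf \<alpha> (\<gamma> - \<delta>) \<gamma>' \<noteq> 0"
        from Kf_size[OF this \<alpha>] show False
          using \<open>size \<gamma> < size \<gamma>'\<close> size_mset_mono[OF diff_subset_eq_self, of \<gamma> \<delta>] by linarith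
      qed
      then show ?thesis by (simp add: M_def)
    qed
    show "(\<Sum>\<gamma> | size \<gamma> \<le> m. \<bar>h \<gamma>\<bar> * ?W \<gamma>) \<le> K / \<bar>B\<bar>" for m
    proof -
      have "(\<Sum>\<gamma> | size \<gamma> \<le> m. \<bar>h \<gamma>\<bar> * ?W \<gamma>) = (\<Sum>\<gamma> | size \<gamma> \<le> m. \<bar>b' {#} \<gamma>\<bar> * ?W \<gamma>) / \<bar>B\<bar>"
        by (simp add: h_def sum_divide_distrib abs_mult)
      also have "\<dots> \<le> K / \<bar>B\<bar>" by (intro divide_right_mono N1) (auto simp: I_def)
      finally show ?thesis .
    qed
  qed (use W col that in auto)
  \<comment> \<open>Coefficients of 1 + I g: the antiderivative moves \<gamma> to \<gamma> + \<beta>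
    with factor \<gamma>! / (\<gamma> + \<beta>)!. As \<beta> is not empty, it leaves the constant
    term alone.\<close>
  define c where "c \<zeta> = (if \<zeta> = {#} then 1 else if \<beta> \<subseteq># \<zeta> then g (\<zeta> - \<beta>) * mfact (\<zeta> - \<beta>) / mfact \<zeta> else 0)" for \<zeta>
  have \<beta>0: "\<beta> \<noteq> {#}" using size\<beta> s by auto
  \<comment> \<open>At most the term \<gamma>' = \<alpha> + \<epsilon> - \<beta> is nonzero, and it
    lies in the range because \<alpha> has at most the order of \<beta>. Writing it as a sum with a
    common range permits the exchange of sums that produces \<open>M\<close>.\<close>
  have cd: "cderiv \<alpha> c \<epsilon> = (if \<alpha> = {#} \<and> \<epsilon> = {#} then 1 else 0) + (\<Sum>\<gamma>' | size \<gamma>' \<le> m. Kf \<alpha> \<epsilon> \<gamma>' * g \<gamma>')"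
    if \<alpha>: "\<alpha> \<in> I" and m: "size \<epsilon> \<le> m" for \<alpha> \<epsilon> m
  proof (cases "\<beta> \<subseteq># \<alpha> + \<epsilon>")
    case True
    define \<gamma>0 where "\<gamma>0 = \<alpha> + \<epsilon> - \<beta>"
    have eq: "\<alpha> + \<epsilon> = \<gamma>0 + \<beta>" using True by (simp add: \<gamma>0_def)
    then have ne: "\<alpha> + \<epsilon> \<noteq> {#}" using \<beta>0 by simp
    have Kf0: "Kf \<alpha> \<epsilon> \<gamma>' = (if \<gamma>' = \<gamma>0 then mfact \<gamma>0 / mfact \<epsilon> else 0)" for \<gamma>'
      by (auto simp: Kf_def eq)
    have "size \<gamma>0 \<le> size \<epsilon>" by (rule Kf_size[OF _ \<alpha>]) (simp add: Kf0)
    then have "(\<Sum>\<gamma>' | size \<gamma>' \<le> m. Kf \<alpha> \<epsilon> \<gamma>' * g \<gamma>') = (\<Sum>\<gamma>'\<in>{\<gamma>0}. Kf \<alpha> \<epsilon> \<gamma>' * g \<gamma>')"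
      using m by (intro sum.mono_neutral_right) (auto simp: Kf0)
    moreover have "cderiv \<alpha> c \<epsilon> = mfact \<gamma>0 / mfact \<epsilon> * g \<gamma>0"
      using True ne by (auto simp: cderiv_def c_def \<gamma>0_def)
    moreover have "\<not> (\<alpha> = {#} \<and> \<epsilon> = {#})" using ne by auto
    ultimately show ?thesis by (simp add: Kf0)
  next
    case False
    then have "Kf \<alpha> \<epsilon> \<gamma>' = 0" for \<gamma>' by (auto simp: Kf_def)
    moreover have "\<alpha> + \<epsilon> = {#} \<longleftrightarrow> \<alpha> = {#} \<and> \<epsilon> = {#}" by auto
    ultimately show ?thesis using False by (simp add: cderiv_def c_def)
  qed
  have "(\<Sum>\<alpha> | size \<alpha> \<le> s. \<Sum>\<delta> | \<delta> \<subseteq># \<gamma>. b \<alpha> \<delta> * cderiv \<alpha> c (\<gamma> - \<delta>)) = 0" for \<gamma>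
  proof -
    let ?m = "size \<gamma>"
    have "(\<Sum>\<alpha>\<in>I. \<Sum>\<delta> | \<delta> \<subseteq># \<gamma>. b \<alpha> \<delta> * cderiv \<alpha> c (\<gamma> - \<delta>))
      = (\<Sum>\<alpha>\<in>I. \<Sum>\<delta> | \<delta> \<subseteq># \<gamma>. (if \<delta> = {#} then if \<alpha> = \<beta> then B * cderiv \<beta> c \<gamma> else 0 else 0) + b' \<alpha> \<delta> * cderiv \<alpha> c (\<gamma> - \<delta>))"
      by (intro sum.cong refl) (auto simp: b'_def B_def)
    also have "\<dots> = B * cderiv \<beta> c \<gamma> + (\<Sum>\<alpha>\<in>I. \<Sum>\<delta> | \<delta> \<subseteq># \<gamma>. b' \<alpha> \<delta> * cderiv \<alpha> c (\<gamma> - \<delta>))"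
      using size\<beta> by (simp add: sum.distrib I_def)
    also have "cderiv \<beta> c \<gamma> = g \<gamma>"
      using \<beta>0 by (simp add: cderiv_def c_def)
    also have "(\<Sum>\<alpha>\<in>I. \<Sum>\<delta> | \<delta> \<subseteq># \<gamma>. b' \<alpha> \<delta> * cderiv \<alpha> c (\<gamma> - \<delta>))
      = (\<Sum>\<alpha>\<in>I. \<Sum>\<delta> | \<delta> \<subseteq># \<gamma>. (if \<delta> = \<gamma> then if \<alpha> = {#} then b' {#} \<gamma> else 0 else 0)
          + (\<Sum>\<gamma>' | size \<gamma>' \<le> ?m. b' \<alpha> \<delta> * Kf \<alpha> (\<gamma> - \<delta>) \<gamma>' * g \<gamma>'))"
    proof (intro sum.cong refl)
      fix \<alpha> \<delta> :: "'n multiset" assume \<alpha>: "\<alpha> \<in> I" and d: "\<delta> \<in> {\<delta>. \<delta> \<subseteq># \<gamma>}"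
      then have "\<gamma> - \<delta> = {#} \<longleftrightarrow> \<delta> = \<gamma>"
        by (auto simp: Diff_eq_empty_iff_mset intro: subset_mset.antisym)
      then show "b' \<alpha> \<delta> * cderiv \<alpha> c (\<gamma> - \<delta>) = (if \<delta> = \<gamma> then if \<alpha> = {#} then b' {#} \<gamma> else 0 else 0)
          + (\<Sum>\<gamma>' | size \<gamma>' \<le> ?m. b' \<alpha> \<delta> * Kf \<alpha> (\<gamma> - \<delta>) \<gamma>' * g \<gamma>')"
        using cd[OF \<alpha>, of "\<gamma> - \<delta>" ?m] size_mset_mono[OF diff_subset_eq_self, of \<gamma> \<delta>]
        by (auto simp: distrib_left sum_distrib_left mult.assoc)
    qed
    also have "\<dots> = b' {#} \<gamma> + (\<Sum>\<alpha>\<in>I. \<Sum>\<delta> | \<delta> \<subseteq># \<gamma>. \<Sum>\<gamma>' | size \<gamma>' \<le> ?m. b' \<alpha> \<delta> * Kf \<alpha> (\<gamma> - \<delta>) \<gamma>' * g \<gamma>')"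
      by (simp add: sum.distrib I_def)
    also have "(\<Sum>\<alpha>\<in>I. \<Sum>\<delta> | \<delta> \<subseteq># \<gamma>. \<Sum>\<gamma>' | size \<gamma>' \<le> ?m. b' \<alpha> \<delta> * Kf \<alpha> (\<gamma> - \<delta>) \<gamma>' * g \<gamma>')
      = (\<Sum>\<gamma>' | size \<gamma>' \<le> ?m. (\<Sum>\<alpha>\<in>I. \<Sum>\<delta> | \<delta> \<subseteq># \<gamma>. b' \<alpha> \<delta> * Kf \<alpha> (\<gamma> - \<delta>) \<gamma>') * g \<gamma>')"
      unfolding sum_distrib_right
      by (subst sum.swap[of _ I "{\<gamma>'. size \<gamma>' \<le> ?m}"], rule sum.cong[OF refl], rule sum.swap)
    also have "\<dots> = (\<Sum>\<gamma>' | size \<gamma>' \<le> ?m. - B * (M \<gamma> \<gamma>' * g \<gamma>'))"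
      using B by (intro sum.cong refl) (simp add: M_def)
    also have "\<dots> = - B * (g \<gamma> - h \<gamma>)"
      using g[of \<gamma> ?m] by (simp only: sum_distrib_left[symmetric]) simp
    also have "b' {#} \<gamma> = - B * h \<gamma>" using B by (simp add: h_def)
    finally show ?thesis by (simp add: I_def algebra_simps)
  qed
  moreover have "c {#} = 1" by (simp add: c_def)
  moreover have "\<exists>R'>0. (\<lambda>\<gamma>. \<bar>c \<gamma>\<bar> * R' ^ size \<gamma>) summable_on UNIV"
  proof (intro exI conjI)
    \<comment> \<open>No count in \<beta> exceeds s, so \<rho> t^s is below every radius r_i;
      dividing by the number of variables absorbs the multinomial coefficient. Hence
      \<open>R' ^ size \<gamma>\<close> is at most the weight of \<gamma>.\<close>
    define R' where "R' = \<rho> * t ^ s / CARD('n)"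
    have "\<rho> * t ^ s \<le> 1" using \<rho> t by (intro mult_le_one power_le_one) auto
    then have "R' \<le> 1 / CARD('n)" unfolding R'_def by (intro divide_right_mono) auto
    also have "\<dots> \<le> 1" by (simp add: Suc_leI)
    finally have R'1: "R' \<le> 1" .
    show R': "R' > 0" using \<rho> t by (simp add: R'_def)
    have RW: "R' ^ size \<gamma> \<le> ?W \<gamma>" for \<gamma>
    proof -
      have "(\<rho> * t ^ s) ^ size \<gamma> \<le> mpow r \<gamma>"
        unfolding mpow_const[symmetric]
      proof (rule mpow_mono)
        fix i
        have "count \<beta> i \<le> s" using size\<beta> count_le_size by metis
        then show "\<rho> * t ^ s \<le> r i"
          unfolding r_def using \<rho> t by (intro mult_left_mono power_decreasing) auto
      qed (use \<rho> t in auto)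
      then have "(\<rho> * t ^ s) ^ size \<gamma> / CARD('n) ^ size \<gamma> \<le> mpow r \<gamma> / arrangements \<gamma>"
        using \<rho> t by (intro frac_le arrangements_le) (auto intro: less_imp_le[OF mpow_pos] r)
      then show ?thesis by (simp add: R'_def weight_def power_divide)
    qed
    have gs: "(\<lambda>\<gamma>. \<bar>g \<gamma>\<bar> * R' ^ size \<gamma>) summable_on UNIV"
    proof (rule nonneg_bdd_above_summable_on)
      show "bdd_above (sum (\<lambda>\<gamma>. \<bar>g \<gamma>\<bar> * R' ^ size \<gamma>) ` {F. F \<subseteq> UNIV \<and> finite F})"
      proof (rule bdd_aboveI2)
        fix F :: "'n multiset set" assume "F \<in> {F. F \<subseteq> UNIV \<and> finite F}"
        then have F: "finite F" by simp
        \<comment> \<open>Every finite set of multi-indices lies below some degree, where the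
          uniform truncated bound \<open>gb\<close> applies.\<close>
        have sub: "F \<subseteq> {\<gamma>. size \<gamma> \<le> Max (size ` F)}" using F by auto
        have "(\<Sum>\<gamma>\<in>F. \<bar>g \<gamma>\<bar> * R' ^ size \<gamma>) \<le> (\<Sum>\<gamma>\<in>F. \<bar>g \<gamma>\<bar> * ?W \<gamma>)"
          by (intro sum_mono mult_left_mono RW) auto
        also have "\<dots> \<le> (\<Sum>\<gamma> | size \<gamma> \<le> Max (size ` F). \<bar>g \<gamma>\<bar> * ?W \<gamma>)"
          by (intro sum_mono2 sub) (auto simp: less_imp_le[OF W])
        also have "\<dots> \<le> (K / \<bar>B\<bar>) / (1 - 1/2)" by (rule gb)
        finally show "(\<Sum>\<gamma>\<in>F. \<bar>g \<gamma>\<bar> * R' ^ size \<gamma>) \<le> (K / \<bar>B\<bar>) / (1 - 1/2)" .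
      qed
    qed (use R' in auto)
    \<comment> \<open>A majorant for the part I g: (\<zeta> - \<beta>)! \<le> \<zeta>! removes the
      factorials, and R' \<le> 1 allows the smaller exponent.\<close>
    define G where "G \<zeta> = (if \<beta> \<subseteq># \<zeta> then \<bar>g (\<zeta> - \<beta>)\<bar> * R' ^ size (\<zeta> - \<beta>) else 0)" for \<zeta>
    have "G summable_on range (\<lambda>\<gamma>. \<gamma> + \<beta>)"
      by (subst summable_on_reindex) (use gs in \<open>auto simp: inj_def o_def G_def\<close>)
    then have "G summable_on UNIV"
    proof (rule summable_on_cong_neutral[THEN iffD1, rotated -1])
      fix \<zeta> assume "\<zeta> \<in> UNIV - range (\<lambda>\<gamma>. \<gamma> + \<beta>)"
      then have "\<not> \<beta> \<subseteq># \<zeta>" by (metis DiffD2 rangeI subset_mset.diff_add)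
      then show "G \<zeta> = 0" by (simp add: G_def)
    qed auto
    moreover have "(\<lambda>\<zeta>. if \<zeta> = {#} then 1 else 0 :: real) summable_on UNIV"
      by (rule finite_nonzero_values_imp_summable_on) simp
    ultimately have "(\<lambda>\<zeta>. (if \<zeta> = {#} then 1 else 0) + G \<zeta>) summable_on UNIV"
      by (intro summable_on_add)
    then show "(\<lambda>\<gamma>. \<bar>c \<gamma>\<bar> * R' ^ size \<gamma>) summable_on UNIV"
    proof (rule summable_on_comparison_real)
      fix \<zeta>
      have G0: "0 \<le> G \<zeta>" using R' by (simp add: G_def)
      show "\<bar>\<bar>c \<zeta>\<bar> * R' ^ size \<zeta>\<bar> \<le> (if \<zeta> = {#} then 1 else 0) + G \<zeta>"
      proof (cases "\<zeta> = {#} \<or> \<not> \<beta> \<subseteq># \<zeta>")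
        case False
        have "mfact (\<zeta> - \<beta>) \<le> mfact \<zeta>" using mfact_mono[of "\<zeta> - \<beta>" \<beta>] False by simp
        then have "mfact (\<zeta> - \<beta>) / mfact \<zeta> \<le> 1" by (simp add: divide_le_eq_1)
        then have "\<bar>c \<zeta>\<bar> \<le> \<bar>g (\<zeta> - \<beta>)\<bar>"
          using False mult_left_mono[of "mfact (\<zeta> - \<beta>) / mfact \<zeta>" 1 "\<bar>g (\<zeta> - \<beta>)\<bar>"]
          by (simp add: c_def abs_mult abs_of_pos)
        moreover have "R' ^ size \<zeta> \<le> R' ^ size (\<zeta> - \<beta>)"
          using R' R'1 False by (intro power_decreasing size_mset_mono diff_subset_eq_self) auto
        ultimately have "\<bar>c \<zeta>\<bar> * R' ^ size \<zeta> \<le> G \<zeta>"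
          using False R' by (auto simp: G_def intro!: mult_mono)
        then show ?thesis using False R' by (simp add: abs_mult)
      qed (use G0 in \<open>auto simp: c_def\<close>)
    qed
  qed
  ultimately show ?thesis by blast
qed

subsection \<open>The adjoint of a linear differential operator\<close>

text \<open>The shape kept by iterated total derivatives in the adjoint of a linear operator: linear
  in the jet of v and free of u. Coefficients above order N are the zero function, so their
  derivatives vanish as well and N can be raised.\<close>

definition linear_in_v_on ::
    "(real^'n::finite) set \<Rightarrow> nat \<Rightarrow> ('n multiset \<Rightarrow> real^'n \<Rightarrow> real) \<Rightarrow> 'n diff_fun \<Rightarrow> bool" where
  "linear_in_v_on \<Omega> N b L \<longleftrightarrow> (\<forall>\<beta>. real_analytic_on (b \<beta>) \<Omega>) \<and> (\<forall>\<beta>. N < size \<beta> \<longrightarrow> b \<beta> = (\<lambda>_. 0)) \<and>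
     (\<forall>x\<in>\<Omega>. \<forall>u v. L x u v = (\<Sum>\<beta> | size \<beta> \<le> N. b \<beta> x * v \<beta>))"

lemma D_v_linear:
  assumes "\<And>v. L x u v = (\<Sum>\<beta> | size \<beta> \<le> N. b \<beta> * v \<beta>)"
  shows "D_v \<alpha> L x u v = (if size \<alpha> \<le> N then b \<alpha> else 0)"
proof -
  have "((\<lambda>t. b \<beta> * (v(\<alpha> := t)) \<beta>) has_real_derivative (if \<beta> = \<alpha> then b \<alpha> else 0)) (at t)" for \<beta> t
    by (auto intro!: derivative_eq_intros)
  then have "((\<lambda>t. \<Sum>\<beta> | size \<beta> \<le> N. b \<beta> * (v(\<alpha> := t)) \<beta>) has_real_derivative
      (\<Sum>\<beta> | size \<beta> \<le> N. if \<beta> = \<alpha> then b \<alpha> else 0)) (at t)" for t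
    by (rule DERIV_sum)
  then have "((\<lambda>t. L x u (v(\<alpha> := t))) has_real_derivative (if size \<alpha> \<le> N then b \<alpha> else 0)) (at t)" for t
    unfolding assms by simp
  then show ?thesis unfolding D_v_def by (rule DERIV_imp_deriv)
qed

lemma D_u_independent:
  assumes "\<And>u u'. L x u v = L x u' v"
  shows "D_u \<alpha> L x u v = 0"
proof -
  have "(\<lambda>t. L x (u(\<alpha> := t)) v) = (\<lambda>t. L x u v)" using assms by blast
  then show ?thesis unfolding D_u_def by simp
qed

lemma real_analytic_on_DERIV:
  assumes "real_analytic_on f S" "x \<in> S"
  shows "((\<lambda>t. f (x + t *\<^sub>R axis i 1)) has_real_derivative partial_deriv i f x) (at 0)"
proof -
  obtain c R where "has_powser f x c R" using assms real_analytic_on_imp_has_powser by blast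
  from has_powser_DERIV[OF this, of i] show ?thesis
    unfolding partial_deriv_def using DERIV_imp_deriv by metis
qed

lemma D_x_linear:
  assumes \<Omega>: "open \<Omega>" "x \<in> \<Omega>" and L: "linear_in_v_on \<Omega> N b L"
  shows "D_x i L x u v = (\<Sum>\<beta> | size \<beta> \<le> N. partial_deriv i (b \<beta>) x * v \<beta>)"
proof -
  have D: "((\<lambda>t. \<Sum>\<beta> | size \<beta> \<le> N. b \<beta> (x + t *\<^sub>R axis i 1) * v \<beta>) has_real_derivative
      (\<Sum>\<beta> | size \<beta> \<le> N. partial_deriv i (b \<beta>) x * v \<beta>)) (at 0)"
    using L \<Omega>(2) unfolding linear_in_v_on_def
    by (intro DERIV_sum DERIV_cmult_right real_analytic_on_DERIV) auto
  \<comment> \<open>The linear form of L is available on \<Omega> only; openness provides it for all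
    small t, which determines the derivative at 0.\<close>
  have ev: "\<forall>\<^sub>F t in nhds 0. L (x + t *\<^sub>R axis i 1) u v = (\<Sum>\<beta> | size \<beta> \<le> N. b \<beta> (x + t *\<^sub>R axis i 1) * v \<beta>)"
  proof -
    have "((\<lambda>t. x + t *\<^sub>R axis i 1) \<longlongrightarrow> x + 0 *\<^sub>R axis i 1) (nhds (0::real))"
      by (intro tendsto_intros filterlim_ident)
    then have "\<forall>\<^sub>F t in nhds (0::real). x + t *\<^sub>R axis i 1 \<in> \<Omega>"
      using topological_tendstoD[OF _ \<Omega>(1)] \<Omega>(2) by fastforce
    then show ?thesis
      by eventually_elim (use L in \<open>auto simp: linear_in_v_on_def\<close>)
  qed
  have "((\<lambda>t. L (x + t *\<^sub>R axis i 1) u v) has_real_derivative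
      (\<Sum>\<beta> | size \<beta> \<le> N. partial_deriv i (b \<beta>) x * v \<beta>)) (at 0)"
    by (rule iffD2[OF DERIV_cong_ev[OF refl ev refl] D])
  then show ?thesis unfolding D_x_def by (rule DERIV_imp_deriv)
qed

lemma partial_deriv_0 [simp]: "partial_deriv i (\<lambda>_. 0) = (\<lambda>_. 0)"
  by (rule ext) (simp add: partial_deriv_def)

text \<open>Leibniz rule: D_i turns b v_\<beta> into a term with v_\<beta>, where b is
  differentiated, and a term with v_(\<beta> + i), where v is. The two summands collect what arrives
  at the same jet coordinate.\<close>

lemma total_deriv_linear:
  assumes \<Omega>: "open \<Omega>" and L: "linear_in_v_on \<Omega> N b L"
  shows "linear_in_v_on \<Omega> (Suc N)
    (\<lambda>\<beta> x. partial_deriv i (b \<beta>) x + (if i \<in># \<beta> then b (\<beta> - {#i#}) x else 0)) (total_deriv i L)"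
  unfolding linear_in_v_on_def
proof (intro conjI allI impI ballI)
  from L have an: "real_analytic_on (b \<beta>) \<Omega>" for \<beta> by (simp add: linear_in_v_on_def)
  show "real_analytic_on (\<lambda>x. partial_deriv i (b \<beta>) x + (if i \<in># \<beta> then b (\<beta> - {#i#}) x else 0)) \<Omega>" for \<beta>
    by (cases "i \<in># \<beta>") (auto intro!: real_analytic_on_add real_analytic_on_partial_deriv an real_analytic_on_0)
  show "(\<lambda>x. partial_deriv i (b \<beta>) x + (if i \<in># \<beta> then b (\<beta> - {#i#}) x else 0)) = (\<lambda>_. 0)" if "Suc N < size \<beta>" for \<beta>
    using L that by (auto simp: linear_in_v_on_def size_Diff_singleton)
  fix x u v assume x: "x \<in> \<Omega>"
  from L x have Lx: "L x u v = (\<Sum>\<beta> | size \<beta> \<le> N. b \<beta> x * v \<beta>)" for u v by (simp add: linear_in_v_on_def)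
  have Du: "D_u \<alpha> L x u v = 0" for \<alpha> by (rule D_u_independent) (simp add: Lx)
  have Dv: "D_v \<alpha> L x u v = (if size \<alpha> \<le> N then b \<alpha> x else 0)" for \<alpha>
    by (rule D_v_linear[where b = "\<lambda>\<beta>. b \<beta> x"]) (rule Lx)
  have 1: "Sum_any (\<lambda>\<alpha>. u (add_mset i \<alpha>) * D_u \<alpha> L x u v) = 0" by (simp add: Du)
  have "Sum_any (\<lambda>\<alpha>. v (add_mset i \<alpha>) * D_v \<alpha> L x u v) = (\<Sum>\<alpha> | size \<alpha> \<le> N. v (add_mset i \<alpha>) * D_v \<alpha> L x u v)"
    by (rule Sum_any.expand_superset) (auto simp: Dv split: if_splits)
  also have "\<dots> = (\<Sum>\<beta> | size \<beta> \<le> Suc N \<and> i \<in># \<beta>. b (\<beta> - {#i#}) x * v \<beta>)"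
    by (rule sum.reindex_bij_witness[of _ "\<lambda>\<beta>. \<beta> - {#i#}" "add_mset i"])
       (auto simp: Dv size_Diff_singleton)
  also have "\<dots> = (\<Sum>\<beta> | size \<beta> \<le> Suc N. (if i \<in># \<beta> then b (\<beta> - {#i#}) x else 0) * v \<beta>)"
    by (rule sum.mono_neutral_cong_left) auto
  finally have 2: "Sum_any (\<lambda>\<alpha>. v (add_mset i \<alpha>) * D_v \<alpha> L x u v)
    = (\<Sum>\<beta> | size \<beta> \<le> Suc N. (if i \<in># \<beta> then b (\<beta> - {#i#}) x else 0) * v \<beta>)" .
  have "(\<Sum>\<beta> | size \<beta> \<le> N. partial_deriv i (b \<beta>) x * v \<beta>) = (\<Sum>\<beta> | size \<beta> \<le> Suc N. partial_deriv i (b \<beta>) x * v \<beta>)"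
    using L by (intro sum.mono_neutral_left) (auto simp: linear_in_v_on_def)
  with D_x_linear[OF \<Omega> x L] have 3: "D_x i L x u v = (\<Sum>\<beta> | size \<beta> \<le> Suc N. partial_deriv i (b \<beta>) x * v \<beta>)" by simp
  show "total_deriv i L x u v = (\<Sum>\<beta> | size \<beta> \<le> Suc N.
      (partial_deriv i (b \<beta>) x + (if i \<in># \<beta> then b (\<beta> - {#i#}) x else 0)) * v \<beta>)"
    unfolding total_deriv_def 1 2 3 by (simp add: distrib_right sum.distrib)
qed

text \<open>Full order is reached only when every total derivative falls on v, which leaves
  \<open>a\<close> undifferentiated at the coordinate \<open>mset is\<close>.\<close>

lemma total_derivs_linear:
  assumes \<Omega>: "open \<Omega>" and a: "real_analytic_on a \<Omega>"
  shows "\<exists>b. linear_in_v_on \<Omega> (length is) b (total_derivs is (\<lambda>x u v. v {#} * a x)) \<and>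
    (\<forall>\<beta>. size \<beta> = length is \<longrightarrow> b \<beta> = (if \<beta> = mset is then a else (\<lambda>_. 0)))"
proof (induction "is")
  case Nil
  have "{\<beta> :: 'a multiset. \<beta> = {#}} = {{#}}" by auto
  then have "linear_in_v_on \<Omega> 0 (\<lambda>\<beta>. if \<beta> = {#} then a else (\<lambda>_. 0)) (\<lambda>x u v. v {#} * a x)"
    using a by (auto simp: linear_in_v_on_def real_analytic_on_0)
  then show ?case
    by (intro exI[of _ "\<lambda>\<beta>. if \<beta> = {#} then a else (\<lambda>_. 0)"]) (auto simp: total_derivs_def)
next
  case (Cons i "is")
  then obtain b where L: "linear_in_v_on \<Omega> (length is) b (total_derivs is (\<lambda>x u v. v {#} * a x))"
    and b: "\<And>\<beta>. size \<beta> = length is \<Longrightarrow> b \<beta> = (if \<beta> = mset is then a else (\<lambda>_. 0))" by blast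
  let ?b = "\<lambda>\<beta> x. partial_deriv i (b \<beta>) x + (if i \<in># \<beta> then b (\<beta> - {#i#}) x else 0)"
  have "linear_in_v_on \<Omega> (length (i # is)) ?b (total_derivs (i # is) (\<lambda>x u v. v {#} * a x))"
    using total_deriv_linear[OF \<Omega> L, of i] by (simp add: total_derivs_def)
  moreover have "?b \<beta> = (if \<beta> = mset (i # is) then a else (\<lambda>_. 0))" if s: "size \<beta> = length (i # is)" for \<beta>
  proof -
    from L s have b0: "b \<beta> = (\<lambda>_. 0)" by (simp add: linear_in_v_on_def)
    show ?thesis
    proof (cases "i \<in># \<beta>")
      case True
      then have "size (\<beta> - {#i#}) = length is" using s by (simp add: size_Diff_singleton)
      moreover have "\<beta> - {#i#} = mset is \<longleftrightarrow> \<beta> = mset (i # is)" using insert_DiffM[OF True] by auto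
      ultimately show ?thesis using True by (auto simp: b0 b)
    qed (auto simp: b0)
  qed
  ultimately show ?case by blast
qed

section \<open>The adjoint and its top-order coefficients\<close>

lemma total_derivs_0: "total_derivs is (\<lambda>x u v. 0) = (\<lambda>x u v. 0)"
  by (induction "is") (auto simp: total_derivs_def total_deriv_def D_x_def D_u_def D_v_def fun_eq_iff)

lemma D_u_linear_diff_op:
  fixes a :: "'n::finite multiset \<Rightarrow> real^'n \<Rightarrow> real"
  shows "D_u \<alpha> (\<lambda>x u v. v {#} * linear_diff_op s a x u) = (\<lambda>x u v. if size \<alpha> \<le> s then v {#} * a \<alpha> x else 0)"
proof (intro ext)
  fix x :: "real^'n" and u v :: "'n jet"
  have "((\<lambda>t. a \<beta> x * (u(\<alpha> := t)) \<beta>) has_real_derivative (if \<beta> = \<alpha> then a \<alpha> x else 0)) (at t)" for \<beta> t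
    by (auto intro!: derivative_eq_intros)
  then have "((\<lambda>t. v {#} * (\<Sum>\<beta> | size \<beta> \<le> s. a \<beta> x * (u(\<alpha> := t)) \<beta>)) has_real_derivative
      v {#} * (\<Sum>\<beta> | size \<beta> \<le> s. if \<beta> = \<alpha> then a \<alpha> x else 0)) (at t)" for t
    by (intro DERIV_cmult DERIV_sum)
  moreover have "v {#} * (\<Sum>\<beta> | size \<beta> \<le> s. if \<beta> = \<alpha> then a \<alpha> x else 0) = (if size \<alpha> \<le> s then v {#} * a \<alpha> x else 0)"
    by simp
  ultimately have "((\<lambda>t. v {#} * linear_diff_op s a x (u(\<alpha> := t))) has_real_derivative
      (if size \<alpha> \<le> s then v {#} * a \<alpha> x else 0)) (at t)" for t
    unfolding linear_diff_op_def by (simp only:)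
  then show "D_u \<alpha> (\<lambda>x u v. v {#} * linear_diff_op s a x u) x u v = (if size \<alpha> \<le> s then v {#} * a \<alpha> x else 0)"
    unfolding D_u_def by (rule DERIV_imp_deriv)
qed

lemma mset_indices [simp]: "mset (indices \<alpha>) = \<alpha>"
  unfolding indices_def by (rule someI_ex) (rule ex_mset)

lemma length_indices [simp]: "length (indices \<alpha>) = size \<alpha>"
  by (metis mset_indices size_mset)

text \<open>The term of \<alpha> has order at most \<open>size \<alpha>\<close> in v with leading
  part a_\<alpha> v_\<alpha>, so a coordinate of order s receives only the contribution of its own
  index. This carries the nonzero coefficient at a regular point over to the adjoint.\<close>

lemma adjoint_fun_linear:
  fixes \<Omega> :: "(real^'n::finite) set"
  assumes \<Omega>: "open \<Omega>" and a: "\<And>\<alpha>. size \<alpha> \<le> s \<Longrightarrow> real_analytic_on (a \<alpha>) \<Omega>"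
  obtains b where "\<And>\<beta>. real_analytic_on (b \<beta>) \<Omega>"
    and "\<And>x u v. x \<in> \<Omega> \<Longrightarrow> adjoint_fun (linear_diff_op s a) x u v = (\<Sum>\<beta> | size \<beta> \<le> s. b \<beta> x * v \<beta>)"
    and "\<And>\<beta> x. size \<beta> = s \<Longrightarrow> b \<beta> x = (-1) ^ s * a \<beta> x"
proof -
  have "\<exists>b. size \<alpha> \<le> s \<longrightarrow> linear_in_v_on \<Omega> (size \<alpha>) b (total_derivs (indices \<alpha>) (\<lambda>x u v. v {#} * a \<alpha> x)) \<and>
    (\<forall>\<beta>. size \<beta> = size \<alpha> \<longrightarrow> b \<beta> = (if \<beta> = \<alpha> then a \<alpha> else (\<lambda>_. 0)))" for \<alpha>
    using total_derivs_linear[OF \<Omega> a, of \<alpha> "indices \<alpha>"] by auto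
  from choice[OF allI, OF this] obtain B where L: "\<And>\<alpha>. size \<alpha> \<le> s \<Longrightarrow> linear_in_v_on \<Omega> (size \<alpha>) (B \<alpha>) (total_derivs (indices \<alpha>) (\<lambda>x u v. v {#} * a \<alpha> x))"
    and top: "\<And>\<alpha> \<beta>. size \<alpha> \<le> s \<Longrightarrow> size \<beta> = size \<alpha> \<Longrightarrow> B \<alpha> \<beta> = (if \<beta> = \<alpha> then a \<alpha> else (\<lambda>_. 0))"
    by fast
  define b where "b \<beta> x = (\<Sum>\<alpha> | size \<alpha> \<le> s. (-1) ^ size \<alpha> * B \<alpha> \<beta> x)" for \<beta> x
  show thesis
  proof (rule that[of b])
    show "real_analytic_on (b \<beta>) \<Omega>" for \<beta>
      unfolding b_def using L
      by (intro real_analytic_on_sum real_analytic_on_cmult) (auto simp: linear_in_v_on_def)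
    show "b \<beta> x = (-1) ^ s * a \<beta> x" if \<beta>: "size \<beta> = s" for \<beta> x
    proof -
      have "B \<alpha> \<beta> x = (if \<alpha> = \<beta> then a \<beta> x else 0)" if \<alpha>: "size \<alpha> \<le> s" for \<alpha>
      proof (cases "size \<alpha> = s")
        case False
        then show ?thesis using L[OF \<alpha>] \<alpha> \<beta> by (auto simp: linear_in_v_on_def)
      qed (use top[OF \<alpha>] \<beta> in auto)
      then have "b \<beta> x = (\<Sum>\<alpha> | size \<alpha> \<le> s. if \<alpha> = \<beta> then (-1) ^ s * a \<beta> x else 0)"
        unfolding b_def using \<beta> by (intro sum.cong) auto
      then show ?thesis using \<beta> by simp
    qed
    fix x u v assume x: "x \<in> \<Omega>"
    let ?T = "\<lambda>\<alpha>. (-1) ^ size \<alpha> * total_derivs (indices \<alpha>) (D_u \<alpha> (\<lambda>x u v. v {#} * linear_diff_op s a x u)) x u v"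
    \<comment> \<open>Beyond order s the derivative with respect to u_\<alpha> is identically zero,
      which reduces \<open>Sum_any\<close> to a finite sum.\<close>
    have "?T \<alpha> = 0" if "\<not> size \<alpha> \<le> s" for \<alpha>
      using that by (simp add: D_u_linear_diff_op total_derivs_0)
    then have "adjoint_fun (linear_diff_op s a) x u v = (\<Sum>\<alpha> | size \<alpha> \<le> s. ?T \<alpha>)"
      unfolding adjoint_fun_def variational_deriv_u_def
      by (intro Sum_any.expand_superset) auto
    also have "\<dots> = (\<Sum>\<alpha> | size \<alpha> \<le> s. \<Sum>\<beta> | size \<beta> \<le> s. (-1) ^ size \<alpha> * B \<alpha> \<beta> x * v \<beta>)"
    proof (rule sum.cong[OF refl])
      fix \<alpha> assume "\<alpha> \<in> {\<alpha> :: 'n multiset. size \<alpha> \<le> s}"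
      then have \<alpha>: "size \<alpha> \<le> s" by simp
      have "?T \<alpha> = (-1) ^ size \<alpha> * (\<Sum>\<beta> | size \<beta> \<le> size \<alpha>. B \<alpha> \<beta> x * v \<beta>)"
        using L[OF \<alpha>] x \<alpha> by (simp add: D_u_linear_diff_op linear_in_v_on_def)
      also have "(\<Sum>\<beta> | size \<beta> \<le> size \<alpha>. B \<alpha> \<beta> x * v \<beta>) = (\<Sum>\<beta> | size \<beta> \<le> s. B \<alpha> \<beta> x * v \<beta>)"
        using L[OF \<alpha>] \<alpha> by (intro sum.mono_neutral_left) (auto simp: linear_in_v_on_def)
      finally show "?T \<alpha> = (\<Sum>\<beta> | size \<beta> \<le> s. (-1) ^ size \<alpha> * B \<alpha> \<beta> x * v \<beta>)"
        by (simp add: sum_distrib_left mult.assoc)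
    qed
    also have "\<dots> = (\<Sum>\<beta> | size \<beta> \<le> s. b \<beta> x * v \<beta>)"
      by (subst sum.swap) (simp add: b_def sum_distrib_right)
    finally show "adjoint_fun (linear_diff_op s a) x u v = (\<Sum>\<beta> | size \<beta> \<le> s. b \<beta> x * v \<beta>)" .
  qed
qed

subsection \<open>Analytic solutions of the adjoint equation\<close>

lemma exists_analytic_solution:
  fixes b :: "'n::finite multiset \<Rightarrow> real^'n \<Rightarrow> real"
  assumes \<Omega>: "open \<Omega>" "x0 \<in> \<Omega>" and s: "s \<ge> 1"
    and b: "\<And>\<beta>. real_analytic_on (b \<beta>) \<Omega>"
    and ex: "\<exists>\<beta>. size \<beta> = s \<and> b \<beta> x0 \<noteq> 0"
  obtains r f where "r > 0" "ball x0 r \<subseteq> \<Omega>" "real_analytic_on f (ball x0 r)" "f x0 \<noteq> 0"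
    and "\<And>x. x \<in> ball x0 r \<Longrightarrow> (\<Sum>\<beta> | size \<beta> \<le> s. b \<beta> x * jet_of f x \<beta>) = 0"
proof -
  have "\<exists>c R. has_powser (b \<beta>) x0 c R" for \<beta>
    using real_analytic_on_imp_has_powser[OF b \<Omega>(2)] .
  then obtain c Q where cQ: "\<And>\<beta>. has_powser (b \<beta>) x0 (c \<beta>) (Q \<beta>)" by metis
  have Q: "Q \<beta> > 0" for \<beta> using cQ[of \<beta>] by (simp add: has_powser_def)
  define R where "R = Min (Q ` {\<beta>. size \<beta> \<le> s})"
  have ne: "{\<beta> :: 'n multiset. size \<beta> \<le> s} \<noteq> {}" by (auto intro: exI[of _ "{#}"])
  have R: "R > 0" unfolding R_def using Q ne by (subst Min_gr_iff) auto
  have cR: "has_powser (b \<beta>) x0 (c \<beta>) R" if "size \<beta> \<le> s" for \<beta>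
    using cQ[of \<beta>] R by (rule has_powser_mono) (use that in \<open>auto simp: R_def\<close>)
  have "\<exists>d R'. R' > 0 \<and> (\<lambda>\<gamma>. \<bar>d \<gamma>\<bar> * R' ^ size \<gamma>) summable_on UNIV \<and> d {#} = 1 \<and>
    (\<forall>\<gamma>. (\<Sum>\<beta> | size \<beta> \<le> s. \<Sum>\<delta> | \<delta> \<subseteq># \<gamma>. c \<beta> \<delta> * cderiv \<beta> d (\<gamma> - \<delta>)) = 0)"
  proof (rule power_series_solution[OF s R])
    show "(\<lambda>\<delta>. \<bar>c \<beta> \<delta>\<bar> * R ^ size \<delta>) summable_on UNIV" if "size \<beta> \<le> s" for \<beta>
      using cR[OF that] by (simp add: has_powser_def)
    show "\<exists>\<beta>. size \<beta> = s \<and> c \<beta> {#} \<noteq> 0"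
      using ex has_powser_center[OF cQ] by metis
  qed
  then obtain d R' where R': "R' > 0" and ds: "(\<lambda>\<gamma>. \<bar>d \<gamma>\<bar> * R' ^ size \<gamma>) summable_on UNIV" and d0: "d {#} = 1"
    and eq: "\<And>\<gamma>. (\<Sum>\<beta> | size \<beta> \<le> s. \<Sum>\<delta> | \<delta> \<subseteq># \<gamma>. c \<beta> \<delta> * cderiv \<beta> d (\<gamma> - \<delta>)) = 0"
    by blast
  define f where "f x = (\<Sum>\<^sub>\<infinity>\<gamma>. d \<gamma> * mpow (($) (x - x0)) \<gamma>)" for x
  have f: "has_powser f x0 d R'"
    by (rule has_powserI[OF R' ds]) (simp add: f_def)
  obtain e where e: "e > 0" "ball x0 e \<subseteq> \<Omega>" using \<Omega> openE by blast
  \<comment> \<open>e keeps the ball inside \<Omega>, R serves the coefficient functions, and up to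
    s differentiations of f each halve its radius R'.\<close>
  define r where "r = min (min e R) (R' / 2 ^ s)"
  have r: "r > 0" "r \<le> e" "r \<le> R" "r \<le> R' / 2 ^ s" using e R R' by (auto simp: r_def)
  have comp: "\<bar>(x - x0) $ i\<bar> \<le> r" if "x \<in> ball x0 r" for x i
    using component_le_norm_cart[of "x - x0" i] that by (simp add: dist_norm norm_minus_commute)
  show thesis
  proof (rule that[of r f])
    show "r > 0" by (rule r)
    show "ball x0 r \<subseteq> \<Omega>" using e(2) r(2) by (meson subset_ball order_trans)
    show "f x0 \<noteq> 0" using has_powser_center[OF f] d0 by simp
    show "real_analytic_on f (ball x0 r)"
      unfolding real_analytic_on_iff_has_powser
    proof
      fix x assume x: "x \<in> ball x0 r"
      \<comment> \<open>Since s \<ge> 1, the ball stays within R' / 2, where the series of f can be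
        recentred.\<close>
      have "R' / 2 ^ s \<le> R' / 2 ^ 1"
        using R' s by (intro divide_left_mono power_increasing) auto
      then have "\<bar>(x - x0) $ i\<bar> \<le> R' / 2" for i
        using comp[OF x, of i] r(4) unfolding power_one_right by linarith
      from has_powser_recenter(1)[OF f this] show "\<exists>c R. has_powser f x c R" by auto
    qed
    fix x assume x: "x \<in> ball x0 r"
    let ?y = "($) (x - x0)"
    \<comment> \<open>The left-hand side of the equation as a sum of Cauchy products; its
      coefficients are those annihilated by \<open>eq\<close>.\<close>
    have "((\<lambda>\<gamma>. \<Sum>\<beta> | size \<beta> \<le> s. (\<Sum>\<delta> | \<delta> \<subseteq># \<gamma>. c \<beta> \<delta> * cderiv \<beta> d (\<gamma> - \<delta>)) * mpow ?y \<gamma>) has_sum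
        (\<Sum>\<beta> | size \<beta> \<le> s. b \<beta> x * jet_of f x \<beta>)) UNIV"
    proof (intro has_sum_finite_sum has_sum_cauchy_product)
      fix \<beta> assume "\<beta> \<in> {\<beta> :: 'n multiset. size \<beta> \<le> s}"
      then have \<beta>: "size \<beta> \<le> s" by simp
      have 1: "\<bar>(x - x0) $ i\<bar> \<le> R" for i using comp[OF x, of i] r(3) by linarith
      with cR[OF \<beta>] have "((\<lambda>\<gamma>. c \<beta> \<gamma> * mpow ?y \<gamma>) has_sum b \<beta> (x0 + (x - x0))) UNIV"
        unfolding has_powser_def by blast
      then show "((\<lambda>\<gamma>. c \<beta> \<gamma> * mpow ?y \<gamma>) has_sum b \<beta> x) UNIV" by simp
      have "R' / 2 ^ s \<le> R' / 2 ^ size \<beta>"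
        using R' \<beta> by (intro divide_left_mono power_increasing) auto
      then have 2: "\<bar>(x - x0) $ i\<bar> \<le> R' / 2 ^ size \<beta>" for i using comp[OF x, of i] r(4) by linarith
      have "has_powser (partial_derivs (indices \<beta>) f) x0 (cderiv \<beta> d) (R' / 2 ^ size \<beta>)"
        using has_powser_partial_derivs[OF f, of "indices \<beta>"] by simp
      with 2 have "((\<lambda>\<gamma>. cderiv \<beta> d \<gamma> * mpow ?y \<gamma>) has_sum partial_derivs (indices \<beta>) f (x0 + (x - x0))) UNIV"
        unfolding has_powser_def by blast
      then show "((\<lambda>\<gamma>. cderiv \<beta> d \<gamma> * mpow ?y \<gamma>) has_sum jet_of f x \<beta>) UNIV" by (simp add: jet_of_def)
    qed
    then have "((\<lambda>\<gamma>. 0) has_sum (\<Sum>\<beta> | size \<beta> \<le> s. b \<beta> x * jet_of f x \<beta>)) (UNIV :: 'n multiset set)"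
      by (simp add: eq flip: sum_distrib_right)
    then show "(\<Sum>\<beta> | size \<beta> \<le> s. b \<beta> x * jet_of f x \<beta>) = 0"
      using has_sum_unique has_sum_0_simp by blast
  qed
qed

theorem proposition0p3p2:
  fixes \<Omega> :: "(real^'n::finite) set"
    and s :: nat
    and a :: "'n multiset \<Rightarrow> real^'n \<Rightarrow> real"
  assumes "open \<Omega>" and "connected \<Omega>"
    and "s \<ge> 1"
    and "\<And>\<alpha>. size \<alpha> \<le> s \<Longrightarrow> real_analytic_on (a \<alpha>) \<Omega>"
    and "\<exists>\<alpha>. size \<alpha> = s \<and> (\<exists>x\<in>\<Omega>. a \<alpha> x \<noteq> 0)"
  shows "\<Omega> \<subseteq> closure (regular_points s a \<Omega>) \<and>
    (\<forall>x0 \<in> regular_points s a \<Omega>. \<exists>U. open U \<and> connected U \<and> x0 \<in> U \<and> U \<subseteq> \<Omega> \<and>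
       nonlinearly_self_adjoint_on (linear_diff_op s a) U)"
proof (intro conjI ballI)
  from assms(5) obtain \<alpha> x1 where \<alpha>: "size \<alpha> = s" and x1: "x1 \<in> \<Omega>" "a \<alpha> x1 \<noteq> 0" by blast
  \<comment> \<open>A single coefficient of order s that is not identically zero already has a dense
    set of nonzero points, all of them regular.\<close>
  have "\<Omega> \<subseteq> closure {x \<in> \<Omega>. a \<alpha> x \<noteq> 0}"
    by (rule real_analytic_on_nonzero_dense[OF assms(1,2) assms(4) x1]) (simp add: \<alpha>)
  also have "\<dots> \<subseteq> closure (regular_points s a \<Omega>)"
    using \<alpha> by (intro closure_mono) (auto simp: regular_points_def)
  finally show "\<Omega> \<subseteq> closure (regular_points s a \<Omega>)" .
next
  fix x0 assume "x0 \<in> regular_points s a \<Omega>"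
  then have x0: "x0 \<in> \<Omega>" and top: "\<exists>\<alpha>. size \<alpha> = s \<and> a \<alpha> x0 \<noteq> 0" by (auto simp: regular_points_def)
  obtain b where b: "\<And>\<beta>. real_analytic_on (b \<beta>) \<Omega>"
    and adj: "\<And>x u v. x \<in> \<Omega> \<Longrightarrow> adjoint_fun (linear_diff_op s a) x u v = (\<Sum>\<beta> | size \<beta> \<le> s. b \<beta> x * v \<beta>)"
    and bs: "\<And>\<beta> x. size \<beta> = s \<Longrightarrow> b \<beta> x = (-1) ^ s * a \<beta> x"
    by (rule adjoint_fun_linear[OF assms(1), of s a]) (use assms(4) in auto)
  from top bs have ex: "\<exists>\<beta>. size \<beta> = s \<and> b \<beta> x0 \<noteq> 0" by auto
  obtain r f where r: "r > 0" "ball x0 r \<subseteq> \<Omega>" and f: "real_analytic_on f (ball x0 r)" "f x0 \<noteq> 0"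
    and sol: "\<And>x. x \<in> ball x0 r \<Longrightarrow> (\<Sum>\<beta> | size \<beta> \<le> s. b \<beta> x * jet_of f x \<beta>) = 0"
    by (rule exists_analytic_solution[OF assms(1) x0 assms(3) b ex]) (rule that)
  \<comment> \<open>Analyticity is required jointly in x and w, so f is extended to be constant in
    w.\<close>
  have "real_analytic_on (\<lambda>z. f (fst z)) (ball x0 r \<times> (UNIV :: real set))"
  proof (rule real_analytic_on_pullback[where e = "\<lambda>i. (axis i 1, 0)"])
    show "inj (\<lambda>i :: 'n. (axis i (1::real), 0 :: real))" by (auto simp: inj_def axis_eq_axis)
    show "range (\<lambda>i :: 'n. (axis i (1::real), 0 :: real)) \<subseteq> Basis" by (auto simp: Basis_prod_def)
    show "fst z $ i = z \<bullet> (axis i 1, 0)" for z :: "(real^'n) \<times> real" and i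
      by (cases z) (simp add: inner_axis)
    show "\<exists>c R. has_powser f (fst z) c R" if "z \<in> ball x0 r \<times> UNIV" for z :: "(real^'n) \<times> real"
      using that f(1) unfolding real_analytic_on_iff_has_powser by auto
  qed
  then have "nonlinearly_self_adjoint_on (linear_diff_op s a) (ball x0 r)"
    unfolding nonlinearly_self_adjoint_on_def
  proof (intro exI[of _ "\<lambda>x w. f x"] conjI allI impI ballI)
    show "\<exists>x\<in>ball x0 r. \<exists>w :: real. f x \<noteq> 0" using r f(2) by (intro bexI[of _ x0]) auto
    fix V u x assume "open V \<and> V \<subseteq> ball x0 r \<and> solution_on (linear_diff_op s a) u V" "x \<in> V"
    then have x: "x \<in> ball x0 r" by blast
    then have "x \<in> \<Omega>" using r(2) by blast
    \<comment> \<open>\<open>adj\<close> expresses the adjoint through the jet of v alone, and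
      substituting \<phi> gives v = f whatever u is, so \<open>sol\<close> is the claim.\<close>
    from adj[OF this] sol[OF x]
    show "adjoint_fun (linear_diff_op s a) x (jet_of u x) (jet_of (\<lambda>y. f y) x) = 0" by simp
  qed (simp add: case_prod_unfold)
  with r show "\<exists>U. open U \<and> connected U \<and> x0 \<in> U \<and> U \<subseteq> \<Omega> \<and> nonlinearly_self_adjoint_on (linear_diff_op s a) U"
    by (intro exI[of _ "ball x0 r"]) auto
qed

end
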